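(* Let $P$ be a flag-symmetric poset of rank $n$ (finite, ranked, with $\hat0$ and $\hat1$) with flag symmetric function $F_P$, and suppose $P$ has an $S$-labeling $\Lambda$. Let $\psi$ be the character of the representation of $S_n$ on $\mathbf{C}\mathcal{M}(P)$ given by the action of $S_n$ on $\mathcal{M}(P)$ induced from the action on labels. (a) If $\Lambda$ is an $RS$-labeling (both an $R$-labeling and an $S$-labeling), then $F_P=\mathrm{ch}(\psi)=h_\nu$ for some partition $\nu=(\nu_1,\nu_2,\dots)$ of $n$, and $P\cong C_{\nu_1+1}\times C_{\nu_2+1}\times\cdots$. (b) If $\Lambda$ is an $R^*S$-labeling (both an $R^*$-labeling and an $S$-labeling), then $\mathrm{ch}(\psi)=\omega F_P$; hence $F_P$ is $e$-positive (a nonnegative integer combination of the $e_\lambda$).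
   Context: For a ranked poset $P$ of rank $n$ with $\hat0,\hat1$ and rank function $\rho$, define $F_P(x)=\sum x_1^{\rho(t_1)}x_2^{\rho(t_2)-\rho(t_1)}\cdots x_{k+1}^{n-\rho(t_k)}$, summed over all $k\ge0$ and all multichains $\hat0\le t_1\le t_2\le\cdots\le t_k<\hat1$. $P$ is flag-symmetric if $F_P$ is a symmetric function, then called the flag symmetric function. $\mathcal{M}(P)$ is the set of maximal chains. A labeling is a map $\Lambda:\mathcal{M}(P)\to L^n$, $L$ totally ordered. It is a $C$-labeling if $\Lambda_r(c)$ depends only on the initial segment $\hat0=w^0\lessdot\cdots\lessdot w^r$ of $c$. A $C$-labeling is an $R$-labeling (resp. $R^*$-labeling) if every chain $\hat0=w^0\lessdot\cdots\lessdot w^r<u$ has a unique completion by coverings $w^r\lessdot w^{r+1}\lessdot\cdots\lessdot w^s=u$ with $\Lambda_{r+1}(c)\le\cdots\le\Lambda_s(c)$ (resp. with strict inequalities), $c$ any maximal chain starting with $w^0\lessdot\cdots\lessdot w^s$. $\Lambda$ is an $S$-labeling if it is injective and for every maximal chain $c$ and $i\in[n-1]$ with $\Lambda_i(c)\ne\Lambda_{i+1}(c)$ there is a unique maximal chain $c'$ differing from $c$ only at rank $i$ whose label is $\Lambda(c)$ with entries $i,i+1$ interchanged. For an $S$-labeling, the action induced from the action on labels is the action of $S_n$ on $\mathcal{M}(P)$ with $\Lambda(\pi\cdot c)=\pi\cdot\Lambda(c)$, where $S_n$ permutes coordinates of sequences. $\mathrm{ch}$ is the Frobenius characteristic, $h_\nu$,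 $e_\nu$ the complete homogeneous and elementary symmetric functions, $\omega$ the standard involution on symmetric functions ($\omega e_\nu=h_\nu$). $C_i$ is an $i$-element chain. *)

theory Defs
  imports Complex_Main "HOL-Combinatorics.Permutations" "HOL-Library.Multiset"
begin

definition partial_order_on' :: "'a set \<Rightarrow> ('a \<Rightarrow> 'a \<Rightarrow> bool) \<Rightarrow> bool" where
  "partial_order_on' P le \<longleftrightarrow>
     (\<forall>x\<in>P. le x x) \<and>
     (\<forall>x\<in>P. \<forall>y\<in>P. le x y \<and> le y x \<longrightarrow> x = y) \<and>
     (\<forall>x\<in>P. \<forall>y\<in>P. \<forall>w\<in>P. le x y \<and> le y w \<longrightarrow> le x w)"

definition covers :: "'a set \<Rightarrow> ('a \<Rightarrow> 'a \<Rightarrow> bool) \<Rightarrow> 'a \<Rightarrow> 'a \<Rightarrow> bool" where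
  "covers P le x y \<longleftrightarrow> x \<in> P \<and> y \<in> P \<and> le x y \<and> x \<noteq> y \<and>
     \<not> (\<exists>w\<in>P. le x w \<and> x \<noteq> w \<and> le w y \<and> w \<noteq> y)"

definition ranked_poset ::
  "'a set \<Rightarrow> ('a \<Rightarrow> 'a \<Rightarrow> bool) \<Rightarrow> ('a \<Rightarrow> nat) \<Rightarrow> nat \<Rightarrow> 'a \<Rightarrow> 'a \<Rightarrow> bool" where
  "ranked_poset P le rho n z t \<longleftrightarrow>
     finite P \<and> partial_order_on' P le \<and> z \<in> P \<and> t \<in> P \<and>
     (\<forall>x\<in>P. le z x \<and> le x t) \<and>
     rho z = 0 \<and> rho t = n \<and>
     (\<forall>x y. covers P le x y \<longrightarrow> rho y = rho x + 1)"

definition max_chains ::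
  "'a set \<Rightarrow> ('a \<Rightarrow> 'a \<Rightarrow> bool) \<Rightarrow> nat \<Rightarrow> 'a \<Rightarrow> 'a \<Rightarrow> 'a list set" where
  "max_chains P le n z t = {c. length c = n + 1 \<and> c ! 0 = z \<and> c ! n = t \<and>
      (\<forall>i<n. covers P le (c ! i) (c ! (i + 1)))}"

text \<open>A series is given by its coefficient function on exponent vectors; the variable
  x_(i+1) of the paper is index i here.  Only finitely supported exponent vectors are
  monomials; all series below have coefficient 0 at non-finitely-supported vectors.\<close>

type_synonym sf = "(nat \<Rightarrow> nat) \<Rightarrow> real"

definition fin_supp :: "(nat \<Rightarrow> nat) \<Rightarrow> bool" where
  "fin_supp \<alpha> \<longleftrightarrow> finite {i. \<alpha> i \<noteq> 0}"

definition deg :: "(nat \<Rightarrow> nat) \<Rightarrow> nat" where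
  "deg \<alpha> = sum \<alpha> {i. \<alpha> i \<noteq> 0}"

definition sf_one :: sf where
  "sf_one \<alpha> = (if \<alpha> = (\<lambda>_. 0) then 1 else 0)"

definition sf_mult :: "sf \<Rightarrow> sf \<Rightarrow> sf" where
  "sf_mult f g \<alpha> = (\<Sum>\<beta>\<in>{\<beta>. \<forall>i. \<beta> i \<le> \<alpha> i}. f \<beta> * g (\<lambda>i. \<alpha> i - \<beta> i))"

definition sf_prod_list :: "sf list \<Rightarrow> sf" where
  "sf_prod_list fs = foldr sf_mult fs sf_one"

definition symmetric_sf :: "sf \<Rightarrow> bool" where
  "symmetric_sf f \<longleftrightarrow> (\<forall>\<pi>. bij \<pi> \<longrightarrow> (\<forall>\<alpha>. f (\<alpha> \<circ> \<pi>) = f \<alpha>))"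

definition h_sf :: "nat \<Rightarrow> sf" where
  "h_sf k \<alpha> = (if fin_supp \<alpha> \<and> deg \<alpha> = k then 1 else 0)"

definition e_sf :: "nat \<Rightarrow> sf" where
  "e_sf k \<alpha> = (if fin_supp \<alpha> \<and> deg \<alpha> = k \<and> (\<forall>i. \<alpha> i \<le> 1) then 1 else 0)"

definition p_sf :: "nat \<Rightarrow> sf" where
  "p_sf k \<alpha> = (if \<exists>i. \<alpha> = (\<lambda>j. if j = i then k else 0) then 1 else 0)"

definition is_partition :: "nat \<Rightarrow> nat list \<Rightarrow> bool" where
  "is_partition n \<nu> \<longleftrightarrow> (\<forall>x\<in>set \<nu>. 0 < x) \<and> sorted_wrt (\<ge>) \<nu> \<and> sum_list \<nu> = n"

definition partitions :: "nat \<Rightarrow> nat list set" where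
  "partitions n = {\<nu>. is_partition n \<nu>}"

definition h_part :: "nat list \<Rightarrow> sf" where
  "h_part \<nu> = sf_prod_list (map h_sf \<nu>)"

definition e_part :: "nat list \<Rightarrow> sf" where
  "e_part \<nu> = sf_prod_list (map e_sf \<nu>)"

definition p_part :: "nat list \<Rightarrow> sf" where
  "p_part \<nu> = sf_prod_list (map p_sf \<nu>)"

definition omega :: "nat \<Rightarrow> sf \<Rightarrow> sf" where
  "omega n f = (THE g. \<exists>c :: nat list \<Rightarrow> real.
      f = (\<lambda>\<alpha>. \<Sum>\<mu>\<in>partitions n. c \<mu> * e_part \<mu> \<alpha>) \<and>
      g = (\<lambda>\<alpha>. \<Sum>\<mu>\<in>partitions n. c \<mu> * h_part \<mu> \<alpha>))"

definition e_positive :: "nat \<Rightarrow> sf \<Rightarrow> bool" where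
  "e_positive n f \<longleftrightarrow> (\<exists>c :: nat list \<Rightarrow> nat.
      f = (\<lambda>\<alpha>. \<Sum>\<mu>\<in>partitions n. real (c \<mu>) * e_part \<mu> \<alpha>))"

definition multichains :: "'a set \<Rightarrow> ('a \<Rightarrow> 'a \<Rightarrow> bool) \<Rightarrow> 'a \<Rightarrow> 'a list set" where
  "multichains P le t = {ts. set ts \<subseteq> P \<and> successively le ts \<and>
      (ts \<noteq> [] \<longrightarrow> last ts \<noteq> t)}"

text \<open>Exponent vector of the monomial
  x_1^rho(t_1) x_2^(rho(t_2)-rho(t_1)) ... x_(k+1)^(n - rho(t_k)) (shifted to index 0).\<close>

definition flag_exp :: "('a \<Rightarrow> nat) \<Rightarrow> 'a \<Rightarrow> 'a \<Rightarrow> 'a list \<Rightarrow> nat \<Rightarrow> nat" where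
  "flag_exp rho z t ts i = (let ext = z # ts @ [t] in
      if i \<le> length ts then rho (ext ! (i + 1)) - rho (ext ! i) else 0)"

definition flag_F ::
  "'a set \<Rightarrow> ('a \<Rightarrow> 'a \<Rightarrow> bool) \<Rightarrow> ('a \<Rightarrow> nat) \<Rightarrow> 'a \<Rightarrow> 'a \<Rightarrow> sf" where
  "flag_F P le rho z t \<alpha> = real (card {ts \<in> multichains P le t. flag_exp rho z t ts = \<alpha>})"

definition flag_symmetric ::
  "'a set \<Rightarrow> ('a \<Rightarrow> 'a \<Rightarrow> bool) \<Rightarrow> ('a \<Rightarrow> nat) \<Rightarrow> 'a \<Rightarrow> 'a \<Rightarrow> bool" where
  "flag_symmetric P le rho z t \<longleftrightarrow> symmetric_sf (flag_F P le rho z t)"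

text \<open>A labeling assigns to each maximal chain a list of n labels; the paper's
  Lambda_r(c) (1 <= r <= n) is  Lam c ! (r - 1).\<close>

definition labeling ::
  "'a set \<Rightarrow> ('a \<Rightarrow> 'a \<Rightarrow> bool) \<Rightarrow> nat \<Rightarrow> 'a \<Rightarrow> 'a \<Rightarrow> ('a list \<Rightarrow> 'l list) \<Rightarrow> bool" where
  "labeling P le n z t Lam \<longleftrightarrow> (\<forall>c\<in>max_chains P le n z t. length (Lam c) = n)"

definition C_labeling ::
  "'a set \<Rightarrow> ('a \<Rightarrow> 'a \<Rightarrow> bool) \<Rightarrow> nat \<Rightarrow> 'a \<Rightarrow> 'a \<Rightarrow> ('a list \<Rightarrow> 'l list) \<Rightarrow> bool" where
  "C_labeling P le n z t Lam \<longleftrightarrow> labeling P le n z t Lam \<and>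
     (\<forall>c\<in>max_chains P le n z t. \<forall>c'\<in>max_chains P le n z t. \<forall>r\<in>{1..n}.
        take (r + 1) c = take (r + 1) c' \<longrightarrow> Lam c ! (r - 1) = Lam c' ! (r - 1))"

definition sat_chain_from_bot :: "'a set \<Rightarrow> ('a \<Rightarrow> 'a \<Rightarrow> bool) \<Rightarrow> 'a \<Rightarrow> 'a list \<Rightarrow> bool" where
  "sat_chain_from_bot P le z ws \<longleftrightarrow> ws \<noteq> [] \<and> ws ! 0 = z \<and>
     (\<forall>i. i + 1 < length ws \<longrightarrow> covers P le (ws ! i) (ws ! (i + 1)))"

definition completion ::
  "'a set \<Rightarrow> ('a \<Rightarrow> 'a \<Rightarrow> bool) \<Rightarrow> 'a list \<Rightarrow> 'a \<Rightarrow> 'a list \<Rightarrow> bool" where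
  "completion P le ws u vs \<longleftrightarrow> vs \<noteq> [] \<and> last vs = u \<and>
     (\<forall>i. i + 1 < length (ws @ vs) \<longrightarrow> length ws \<le> i + 1 \<longrightarrow>
        covers P le ((ws @ vs) ! i) ((ws @ vs) ! (i + 1)))"

text \<open>For ws of length r+1 and vs of length s-r, the labels
  Lambda_(r+1)(c), ..., Lambda_s(c) are  take (length vs) (drop (length ws - 1) (Lam c)).\<close>

definition R_labeling_gen ::
  "('l list \<Rightarrow> bool) \<Rightarrow> 'a set \<Rightarrow> ('a \<Rightarrow> 'a \<Rightarrow> bool) \<Rightarrow> nat \<Rightarrow> 'a \<Rightarrow> 'a \<Rightarrow>
     ('a list \<Rightarrow> 'l::linorder list) \<Rightarrow> bool" where
  "R_labeling_gen incr P le n z t Lam \<longleftrightarrow> C_labeling P le n z t Lam \<and>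
     (\<forall>ws u. sat_chain_from_bot P le z ws \<and> u \<in> P \<and> le (last ws) u \<and> last ws \<noteq> u \<longrightarrow>
        (\<exists>!vs. completion P le ws u vs \<and>
           (\<forall>c\<in>max_chains P le n z t. take (length ws + length vs) c = ws @ vs \<longrightarrow>
              incr (take (length vs) (drop (length ws - 1) (Lam c))))))"

definition R_labeling ::
  "'a set \<Rightarrow> ('a \<Rightarrow> 'a \<Rightarrow> bool) \<Rightarrow> nat \<Rightarrow> 'a \<Rightarrow> 'a \<Rightarrow> ('a list \<Rightarrow> 'l::linorder list) \<Rightarrow> bool" where
  "R_labeling = R_labeling_gen (sorted_wrt (\<le>))"

definition Rstar_labeling ::
  "'a set \<Rightarrow> ('a \<Rightarrow> 'a \<Rightarrow> bool) \<Rightarrow> nat \<Rightarrow> 'a \<Rightarrow> 'a \<Rightarrow> ('a list \<Rightarrow> 'l::linorder list) \<Rightarrow> bool" where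
  "Rstar_labeling = R_labeling_gen (sorted_wrt (<))"

definition S_labeling ::
  "'a set \<Rightarrow> ('a \<Rightarrow> 'a \<Rightarrow> bool) \<Rightarrow> nat \<Rightarrow> 'a \<Rightarrow> 'a \<Rightarrow> ('a list \<Rightarrow> 'l list) \<Rightarrow> bool" where
  "S_labeling P le n z t Lam \<longleftrightarrow> labeling P le n z t Lam \<and>
     inj_on Lam (max_chains P le n z t) \<and>
     (\<forall>c\<in>max_chains P le n z t. \<forall>i\<in>{1..n-1}.
        Lam c ! (i - 1) \<noteq> Lam c ! i \<longrightarrow>
        (\<exists>!c'. c' \<in> max_chains P le n z t \<and> (\<forall>j. j \<noteq> i \<longrightarrow> c' ! j = c ! j) \<and>
             Lam c' = (Lam c)[i - 1 := Lam c ! i, i := Lam c ! (i - 1)]))"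

text \<open>S_n = permutations of {0..<n}; pi acts on sequences by permuting coordinates:
  (pi . s)_(pi j) = s_j.\<close>

definition perm_seq :: "(nat \<Rightarrow> nat) \<Rightarrow> 'l list \<Rightarrow> 'l list" where
  "perm_seq \<pi> s = permute_list (inv \<pi>) s"

definition induced_action ::
  "'a set \<Rightarrow> ('a \<Rightarrow> 'a \<Rightarrow> bool) \<Rightarrow> nat \<Rightarrow> 'a \<Rightarrow> 'a \<Rightarrow> ('a list \<Rightarrow> 'l list) \<Rightarrow>
     (nat \<Rightarrow> nat) \<Rightarrow> 'a list \<Rightarrow> 'a list" where
  "induced_action P le n z t Lam \<pi> c =
     (THE c'. c' \<in> max_chains P le n z t \<and> Lam c' = perm_seq \<pi> (Lam c))"

text \<open>Character of the permutation representation on C M(P): number of fixed chains.\<close>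

definition perm_character ::
  "'a set \<Rightarrow> ('a \<Rightarrow> 'a \<Rightarrow> bool) \<Rightarrow> nat \<Rightarrow> 'a \<Rightarrow> 'a \<Rightarrow> ('a list \<Rightarrow> 'l list) \<Rightarrow>
     (nat \<Rightarrow> nat) \<Rightarrow> nat" where
  "perm_character P le n z t Lam \<pi> =
     card {c \<in> max_chains P le n z t. induced_action P le n z t Lam \<pi> c = c}"

definition perm_orbit :: "(nat \<Rightarrow> nat) \<Rightarrow> nat \<Rightarrow> nat set" where
  "perm_orbit \<pi> i = {(\<pi> ^^ k) i | k. True}"

definition cycle_type :: "nat \<Rightarrow> (nat \<Rightarrow> nat) \<Rightarrow> nat list" where
  "cycle_type n \<pi> = rev (sorted_list_of_multiset
      (image_mset card (mset_set (perm_orbit \<pi> ` {..<n}))))"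

definition frobenius_ch :: "nat \<Rightarrow> ((nat \<Rightarrow> nat) \<Rightarrow> real) \<Rightarrow> sf" where
  "frobenius_ch n \<chi> = (\<lambda>\<alpha>. (1 / fact n) *
      (\<Sum>\<pi>\<in>{\<pi>. \<pi> permutes {..<n}}. \<chi> \<pi> * p_part (cycle_type n \<pi>) \<alpha>))"

definition chain_product :: "nat list \<Rightarrow> nat list set" where
  "chain_product \<nu> = {xs. length xs = length \<nu> \<and> (\<forall>i<length \<nu>. xs ! i \<le> \<nu> ! i)}"

definition iso_to_chain_product :: "'a set \<Rightarrow> ('a \<Rightarrow> 'a \<Rightarrow> bool) \<Rightarrow> nat list \<Rightarrow> bool" where
  "iso_to_chain_product P le \<nu> \<longleftrightarrow> (\<exists>f. bij_betw f P (chain_product \<nu>) \<and>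
     (\<forall>x\<in>P. \<forall>y\<in>P. le x y \<longleftrightarrow> list_all2 (\<le>) (f x) (f y)))"

end

theory Submission
  imports Defs "HOL-Library.Product_Lexorder" "HOL-Combinatorics.Cycles"
begin

text \<open>
  The label words of an \<open>S\<close>-labeling form a union of full rearrangement classes. By Burnside's
  lemma, the coefficient of \<open>x\<^sup>\<alpha>\<close> in \<open>ch \<psi>\<close> counts the orbits of pairs (label word, colouring of the
  positions with content \<open>\<alpha>\<close>), that is, the label words that increase weakly on the consecutive
  blocks of lengths \<open>\<alpha>\<^sub>0, \<alpha>\<^sub>1, \<dots>\<close>. For an \<open>R\<close>-labeling (resp. \<open>R\<^sup>*\<close>-labeling) the coefficient of
  \<open>x\<^sup>\<alpha>\<close> in the flag symmetric function counts the label words that increase weakly (resp. strictly)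
  on these blocks, because every multichain refines uniquely to a block-increasing maximal chain.
  A single class whose letters have multiplicities \<open>\<mu>\<close> contributes \<open>h\<^sub>\<mu>\<close> in the weak case and
  \<open>e\<^sub>\<mu>\<close> in the strict case, which gives part (b).

  In part (a), uniqueness of the increasing chain from bottom to top leaves one class, with content
  \<open>m\<close> say. The multiset of labels below \<open>x\<close> does not depend on the chain chosen, and sending \<open>x\<close> to
  it is an isomorphism onto the submultisets of \<open>m\<close>, a product of chains.
\<close>

subsection \<open>Products of indicator series as counts of exponent matrices\<close>

text \<open>All counts are expressed through lists of pairs (block, letter) in lexicographic order.
  A fixed-word count times a fixed-colouring count is a fixed-list count, so Burnside turns
  \<open>ch\<close> into a count of sorted lists; cutting label words into blocks gives lists of the
  same kind on the flag side. The weak and strict cases then differ only in the relation inside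
  \<open>lex_rel\<close>, and the multiplicity tables of such lists are the tables that expand
  products of h or e.

  \<open>omega\<close> is a definite description over expansions in the e products, so it can be
  evaluated only once these products are known to be linearly independent; hence the triangularity
  argument.

  The isomorphism rests on locality: an adjacent swap of labels changes the chain at a single rank,
  so rearranging the labels of a segment leaves the ends of the segment in place. Labels below an
  element can therefore be sorted without losing the element, and a chain through prescribed
  elements can be built from its label word.\<close>

definition exp_matrices :: "('b \<Rightarrow> (nat \<Rightarrow> nat) set) \<Rightarrow> 'b set \<Rightarrow> (nat \<Rightarrow> nat) \<Rightarrow> ('b \<Rightarrow> nat \<Rightarrow> nat) set" where
  "exp_matrices B S \<alpha> = {b. (\<forall>l\<in>S. b l \<in> B l) \<and> (\<forall>l. l \<notin> S \<longrightarrow> b l = (\<lambda>_. 0)) \<and>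
     (\<forall>i. (\<Sum>l\<in>S. b l i) = \<alpha> i)}"

lemma finite_exponents_below:
  assumes "fin_supp \<alpha>"
  shows "finite {\<beta>. \<forall>i. \<beta> i \<le> \<alpha> i}"
proof -
  have "finite {\<beta>. \<forall>i. (i \<in> {i. \<alpha> i \<noteq> 0} \<longrightarrow> \<beta> i \<in> {..Max (\<alpha> ` {i. \<alpha> i \<noteq> 0})}) \<and>
      (i \<notin> {i. \<alpha> i \<noteq> 0} \<longrightarrow> \<beta> i = 0)}"
    by (rule finite_set_of_finite_funs) (use assms in \<open>auto simp: fin_supp_def\<close>)
  moreover have "{\<beta>. \<forall>i. \<beta> i \<le> \<alpha> i} \<subseteq> {\<beta>. \<forall>i. (i \<in> {i. \<alpha> i \<noteq> 0} \<longrightarrow>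
      \<beta> i \<in> {..Max (\<alpha> ` {i. \<alpha> i \<noteq> 0})}) \<and> (i \<notin> {i. \<alpha> i \<noteq> 0} \<longrightarrow> \<beta> i = 0)}"
  proof (clarify, intro conjI impI)
    fix \<beta> i assume le: "\<forall>i. \<beta> i \<le> \<alpha> i"
    { assume "i \<in> {i. \<alpha> i \<noteq> 0}"
      then have "\<alpha> i \<le> Max (\<alpha> ` {i. \<alpha> i \<noteq> 0})"
        using assms by (intro Max_ge) (auto simp: fin_supp_def)
      then show "\<beta> i \<in> {..Max (\<alpha> ` {i. \<alpha> i \<noteq> 0})}" using le[rule_format, of i] by simp }
    { assume "i \<notin> {i. \<alpha> i \<noteq> 0}"
      then show "\<beta> i = 0" using le[rule_format, of i] by simp }
  qed
  ultimately show ?thesis by (rule rev_finite_subset)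
qed

text \<open>\<open>sf_mult\<close> then sums over an infinite index set, which yields 0 by
  convention; this is how products of series vanish off the monomials. The unit vectors at the
  support of \<alpha> already give infinitely many exponents.\<close>

lemma infinite_exponents_below:
  assumes "\<not> fin_supp \<alpha>"
  shows "infinite {\<beta>. \<forall>i. \<beta> i \<le> \<alpha> i}"
proof
  assume fin: "finite {\<beta>. \<forall>i. \<beta> i \<le> \<alpha> i}"
  have "inj_on (\<lambda>i j. if j = i then 1 else (0::nat)) {i. \<alpha> i \<noteq> 0}"
    by (rule inj_onI) (metis zero_neq_one)
  moreover have "(\<lambda>i j. if j = i then 1 else (0::nat)) ` {i. \<alpha> i \<noteq> 0} \<subseteq> {\<beta>. \<forall>i. \<beta> i \<le> \<alpha> i}"
    by auto
  then have "finite ((\<lambda>i j. if j = i then 1 else (0::nat)) ` {i. \<alpha> i \<noteq> 0})"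
    using fin by (rule finite_subset)
  ultimately have "finite {i. \<alpha> i \<noteq> 0}"
    using finite_imageD by blast
  then show False using assms by (simp add: fin_supp_def)
qed

lemma fin_supp_diff: "fin_supp \<alpha> \<Longrightarrow> fin_supp (\<lambda>i. \<alpha> i - \<beta> i)"
  unfolding fin_supp_def by (rule finite_subset[rotated]) auto

lemma fin_supp_count: "fin_supp (count M)"
  unfolding fin_supp_def by (rule finite_subset[OF _ finite_set_mset[of M]]) (auto simp: count_eq_zero_iff)

lemma sf_prod_list_not_fin_supp:
  assumes "\<not> fin_supp \<alpha>"
  shows "sf_prod_list fs \<alpha> = 0"
proof (cases fs)
  case Nil
  then show ?thesis using assms by (auto simp: sf_prod_list_def sf_one_def fin_supp_def)
next
  case (Cons f gs)
  then show ?thesis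
    using infinite_exponents_below[OF assms] by (simp add: sf_prod_list_def sf_mult_def)
qed

lemma finite_exp_matrices:
  assumes "finite S" "fin_supp \<alpha>"
  shows "finite (exp_matrices B S \<alpha>)"
proof -
  have "finite {b. \<forall>l. (l \<in> S \<longrightarrow> b l \<in> {\<beta>. \<forall>i. \<beta> i \<le> \<alpha> i}) \<and> (l \<notin> S \<longrightarrow> b l = (\<lambda>_. 0))}"
    by (rule finite_set_of_finite_funs[OF assms(1) finite_exponents_below[OF assms(2)]])
  moreover have "exp_matrices B S \<alpha> \<subseteq>
      {b. \<forall>l. (l \<in> S \<longrightarrow> b l \<in> {\<beta>. \<forall>i. \<beta> i \<le> \<alpha> i}) \<and> (l \<notin> S \<longrightarrow> b l = (\<lambda>_. 0))}"
  proof (clarify, intro conjI impI)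
    fix b l assume b: "b \<in> exp_matrices B S \<alpha>"
    { assume "l \<in> S"
      then have "b l i \<le> (\<Sum>l\<in>S. b l i)" for i
        using assms(1) by (intro member_le_sum) auto
      then show "b l \<in> {\<beta>. \<forall>i. \<beta> i \<le> \<alpha> i}" using b by (simp add: exp_matrices_def) }
    { assume "l \<notin> S"
      then show "b l = (\<lambda>_. 0)" using b by (simp add: exp_matrices_def) }
  qed
  ultimately show ?thesis by (rule rev_finite_subset)
qed

text \<open>Splitting off row \<open>l\<close> as \<beta> leaves a table with column sums \<alpha> -
  \<beta>, which is the convolution in \<open>sf_mult\<close>. The bound \<beta> \<le> \<alpha>
  makes the truncated subtraction exact.\<close>

lemma bij_betw_exp_matrices_insert:
  assumes "finite S" "l \<notin> S"
  shows "bij_betw (\<lambda>(\<beta>, b). b(l := \<beta>))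
    (SIGMA \<beta>:{\<beta>. \<forall>i. \<beta> i \<le> \<alpha> i} \<inter> B l. exp_matrices B S (\<lambda>i. \<alpha> i - \<beta> i))
    (exp_matrices B (insert l S) \<alpha>)"
proof (rule bij_betw_byWitness[where f' = "\<lambda>b. (b l, b(l := (\<lambda>_. 0)))"])
  show "(\<lambda>(\<beta>, b). b(l := \<beta>)) `
      (SIGMA \<beta>:{\<beta>. \<forall>i. \<beta> i \<le> \<alpha> i} \<inter> B l. exp_matrices B S (\<lambda>i. \<alpha> i - \<beta> i))
      \<subseteq> exp_matrices B (insert l S) \<alpha>"
  proof clarify
    fix \<beta> b
    assume le: "\<forall>i. \<beta> i \<le> \<alpha> i" and B: "\<beta> \<in> B l" and b: "b \<in> exp_matrices B S (\<lambda>i. \<alpha> i - \<beta> i)"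
    have "(\<Sum>k\<in>insert l S. (b(l := \<beta>)) k i) = \<alpha> i" for i
    proof -
      have "(\<Sum>k\<in>S. (b(l := \<beta>)) k i) = (\<Sum>k\<in>S. b k i)"
        using assms by (intro sum.cong) auto
      then show ?thesis using assms b le by (simp add: exp_matrices_def)
    qed
    then show "b(l := \<beta>) \<in> exp_matrices B (insert l S) \<alpha>"
      using B b assms by (auto simp: exp_matrices_def)
  qed
  show "(\<lambda>b. (b l, b(l := (\<lambda>_. 0)))) ` exp_matrices B (insert l S) \<alpha> \<subseteq>
      (SIGMA \<beta>:{\<beta>. \<forall>i. \<beta> i \<le> \<alpha> i} \<inter> B l. exp_matrices B S (\<lambda>i. \<alpha> i - \<beta> i))"
  proof (rule image_subsetI)
    fix b assume b: "b \<in> exp_matrices B (insert l S) \<alpha>"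
    have eq: "b l i + (\<Sum>k\<in>S. b k i) = \<alpha> i" for i
      using b assms by (simp add: exp_matrices_def)
    have "(\<Sum>k\<in>S. (b(l := (\<lambda>_. 0))) k i) = (\<Sum>k\<in>S. b k i)" for i
      using assms by (intro sum.cong) auto
    then have "(\<Sum>k\<in>S. (b(l := (\<lambda>_. 0))) k i) = \<alpha> i - b l i" for i
      using eq[of i] by simp
    moreover have "b l i \<le> \<alpha> i" for i using eq[of i] by simp
    ultimately show "(b l, b(l := (\<lambda>_. 0))) \<in>
        (SIGMA \<beta>:{\<beta>. \<forall>i. \<beta> i \<le> \<alpha> i} \<inter> B l. exp_matrices B S (\<lambda>i. \<alpha> i - \<beta> i))"
      using b assms by (auto simp: exp_matrices_def)
  qed
qed (use assms in \<open>auto simp: exp_matrices_def fun_eq_iff\<close>)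

text \<open>A table picks one exponent from each factor, row by row, with total \<alpha>. Factors
  are addressed by distinct indices, so a repeated factor occurs under several indices; zero rows
  outside the index set make a table determined by its picks.\<close>

lemma sf_prod_list_indicators:
  assumes "fin_supp \<alpha>" "distinct ls"
  shows "sf_prod_list (map (\<lambda>l \<beta>. if \<beta> \<in> B l then 1 else 0) ls) \<alpha> =
    real (card (exp_matrices B (set ls) \<alpha>))"
  using assms
proof (induction ls arbitrary: \<alpha>)
  case Nil
  have "exp_matrices B {} \<alpha> = (if \<alpha> = (\<lambda>_. 0) then {\<lambda>_ _. 0} else {})"
    by (auto simp: exp_matrices_def fun_eq_iff)
  then show ?case by (simp add: sf_prod_list_def sf_one_def)
next
  case (Cons l ls)
  let ?D = "{\<beta>. \<forall>i. \<beta> i \<le> \<alpha> i}"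
  have fD: "finite ?D" using finite_exponents_below Cons.prems by blast
  have "sf_prod_list (map (\<lambda>l \<beta>. if \<beta> \<in> B l then 1 else 0) (l # ls)) \<alpha> =
      (\<Sum>\<beta>\<in>?D. (if \<beta> \<in> B l then 1 else 0) *
        real (card (exp_matrices B (set ls) (\<lambda>i. \<alpha> i - \<beta> i))))"
    using Cons.IH Cons.prems fin_supp_diff
    by (simp add: sf_prod_list_def sf_mult_def)
  also have "\<dots> = (\<Sum>\<beta>\<in>?D \<inter> B l. real (card (exp_matrices B (set ls) (\<lambda>i. \<alpha> i - \<beta> i))))"
    using fD by (simp add: sum.inter_restrict if_distrib[where f="\<lambda>x. x * _"] cong: if_cong)
  also have "\<dots> = real (card (SIGMA \<beta>:?D \<inter> B l. exp_matrices B (set ls) (\<lambda>i. \<alpha> i - \<beta> i)))"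
    using fD Cons.prems by (subst card_SigmaI) (auto intro: finite_exp_matrices fin_supp_diff)
  also have "\<dots> = real (card (exp_matrices B (set (l # ls)) \<alpha>))"
    using bij_betw_same_card[OF bij_betw_exp_matrices_insert[of "set ls" l \<alpha> B]] Cons.prems by simp
  finally show ?case .
qed

lemma count_image_snd:
  fixes M :: "('b \<times> 'c) multiset"
  shows "finite {i. count M (i, l) \<noteq> 0}"
    and "(\<Sum>i\<in>{i. count M (i, l) \<noteq> 0}. count M (i, l)) = count (image_mset snd M) l"
proof -
  have eq: "snd -` {l} \<inter> set_mset M = (\<lambda>i. (i, l)) ` {i. count M (i, l) \<noteq> 0}"
    by (auto simp: image_iff)
  then have "finite ((\<lambda>i. (i, l)) ` {i. count M (i, l) \<noteq> 0})"
    by (metis finite_Int finite_set_mset)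
  then show fin: "finite {i. count M (i, l) \<noteq> 0}"
    by (rule finite_imageD) (simp add: inj_on_def)
  show "(\<Sum>i\<in>{i. count M (i, l) \<noteq> 0}. count M (i, l)) = count (image_mset snd M) l"
    unfolding count_image_mset eq by (subst sum.reindex) (simp_all add: inj_on_def)
qed

lemma count_image_fst:
  fixes M :: "('b \<times> 'c) multiset"
  assumes "finite S" "set_mset (image_mset snd M) \<subseteq> S"
  shows "(\<Sum>l\<in>S. count M (i, l)) = count (image_mset fst M) i"
proof -
  have "(\<Sum>l\<in>S. count M (i, l)) = (\<Sum>x\<in>(\<lambda>l. (i, l)) ` S. count M x)"
    by (subst sum.reindex) (simp_all add: inj_on_def)
  also have "\<dots> = (\<Sum>x\<in>fst -` {i} \<inter> set_mset M. count M x)"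
    by (rule sum.mono_neutral_right)
       (use assms in \<open>auto simp: image_iff subset_iff not_in_iff\<close>)
  finally show ?thesis by (simp add: count_image_mset)
qed

text \<open>Read a multiset of pairs as its table of multiplicities: row \<open>l\<close> sums to
  the multiplicity of \<open>l\<close> in \<open>m\<close>, and column \<open>i\<close> to the
  exponent at \<open>i\<close>.\<close>

lemma exp_matrices_mset:
  fixes m :: "'l multiset"
  assumes "fin_supp \<alpha>"
  shows "bij_betw (\<lambda>M l i. count M (i, l))
    {M :: (nat \<times> 'l) multiset. image_mset snd M = m \<and> count (image_mset fst M) = \<alpha>}
    (exp_matrices (\<lambda>l. {\<beta>. fin_supp \<beta> \<and> deg \<beta> = count m l}) (set_mset m) \<alpha>)"
  unfolding bij_betw_def
proof
  let ?X = "{M :: (nat \<times> 'l) multiset. image_mset snd M = m \<and> count (image_mset fst M) = \<alpha>}"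
  let ?Y = "exp_matrices (\<lambda>l. {\<beta>. fin_supp \<beta> \<and> deg \<beta> = count m l}) (set_mset m) \<alpha>"
  show "inj_on (\<lambda>M l i. count M (i, l)) ?X"
    by (rule inj_onI) (auto simp: multiset_eq_iff fun_eq_iff)
  show "(\<lambda>M l i. count M (i, l)) ` ?X = ?Y"
  proof (intro equalityI subsetI)
    fix b assume "b \<in> (\<lambda>M l i. count M (i, l)) ` ?X"
    then obtain M where M: "image_mset snd M = m" "count (image_mset fst M) = \<alpha>"
      and b: "b = (\<lambda>l i. count M (i, l))" by auto
    have "fin_supp (b l)" "deg (b l) = count m l" for l
      using count_image_snd[of M l] M b by (auto simp: fin_supp_def deg_def)
    moreover have "b l = (\<lambda>_. 0)" if "l \<notin> set_mset m" for l
    proof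
      fix i
      have "(i, l) \<notin># M" using that M(1) by force
      then show "b l i = 0" by (simp add: b not_in_iff)
    qed
    moreover have "(\<Sum>l\<in>set_mset m. b l i) = \<alpha> i" for i
      using count_image_fst[of "set_mset m" M i] M b by simp
    ultimately show "b \<in> ?Y" by (simp add: exp_matrices_def)
  next
    fix b assume b: "b \<in> ?Y"
    \<comment> \<open>Finitely many letters, each with a row of finite support: this licenses
      \<open>Abs_multiset\<close>.\<close>
    have fin: "finite {x. 0 < (\<lambda>(i, l). b l i) x}"
    proof (rule finite_subset)
      show "{x. 0 < (\<lambda>(i, l). b l i) x} \<subseteq> (\<Union>l\<in>set_mset m. (\<lambda>i. (i, l)) ` {i. b l i \<noteq> 0})"
      proof
        fix x assume x: "x \<in> {x. 0 < (\<lambda>(i, l). b l i) x}"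
        obtain i l where il: "x = (i, l)" by force
        have "l \<in># m"
        proof (rule ccontr)
          assume "l \<notin># m"
          then have "b l = (\<lambda>_. 0)" using b by (simp add: exp_matrices_def)
          then show False using x il by simp
        qed
        then show "x \<in> (\<Union>l\<in>set_mset m. (\<lambda>i. (i, l)) ` {i. b l i \<noteq> 0})"
          using x il by auto
      qed
      show "finite (\<Union>l\<in>set_mset m. (\<lambda>i. (i, l)) ` {i. b l i \<noteq> 0})"
        using b by (intro finite_UN_I) (auto simp: exp_matrices_def fin_supp_def)
    qed
    define M where "M = Abs_multiset (\<lambda>(i, l). b l i)"
    have cM: "count M (i, l) = b l i" for i l
      using fin by (simp add: M_def)
    have snd: "image_mset snd M = m"
    proof (rule multiset_eqI)
      fix l
      have *: "count (image_mset snd M) l = deg (b l)"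
        using count_image_snd(2)[of M l] by (simp add: cM deg_def)
      show "count (image_mset snd M) l = count m l"
      proof (cases "l \<in># m")
        case True
        then show ?thesis using b * by (simp add: exp_matrices_def)
      next
        case False
        then have "b l = (\<lambda>_. 0)" using b by (simp add: exp_matrices_def)
        then show ?thesis using * False by (simp add: deg_def not_in_iff)
      qed
    qed
    have "count (image_mset fst M) = \<alpha>"
    proof
      fix i
      have "count (image_mset fst M) i = (\<Sum>l\<in>set_mset m. count M (i, l))"
        using count_image_fst[of "set_mset m" M i] snd by simp
      then show "count (image_mset fst M) i = \<alpha> i" using b by (simp add: cM exp_matrices_def)
    qed
    then have "M \<in> ?X" using snd by simp
    moreover have "b = (\<lambda>l i. count M (i, l))" by (simp add: cM fun_eq_iff)
    ultimately show "b \<in> (\<lambda>M l i. count M (i, l)) ` ?X" by (rule rev_image_eqI)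
  qed
qed

text \<open>Decreasing multiplicity makes \<open>mset_type\<close> a partition; the same enumeration
  later indexes the coordinates of the product of chains.\<close>

definition letters :: "'l::linorder multiset \<Rightarrow> 'l list" where
  "letters m = rev (sort_key (count m) (sorted_list_of_set (set_mset m)))"

definition mset_type :: "'l::linorder multiset \<Rightarrow> nat list" where
  "mset_type m = map (count m) (letters m)"

lemma set_letters: "set (letters m) = set_mset m"
  and distinct_letters: "distinct (letters m)"
  by (simp_all add: letters_def)

lemma is_partition_mset_type: "is_partition (size m) (mset_type m)"
proof -
  have "sorted_wrt (\<ge>) (mset_type m)"
    unfolding mset_type_def letters_def rev_map[symmetric] sorted_wrt_rev by simp
  moreover have "sum_list (mset_type m) = size m"
    unfolding mset_type_def using sum_list_distinct_conv_sum_set[OF distinct_letters, of "count m" m]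
    by (simp add: set_letters size_multiset_overloaded_eq)
  moreover have "0 < x" if "x \<in> set (mset_type m)" for x
    using that by (auto simp: mset_type_def set_letters)
  ultimately show ?thesis by (simp add: is_partition_def)
qed

lemma bij_betw_mset_sorted:
  fixes Q :: "'b::linorder multiset \<Rightarrow> bool"
  shows "bij_betw mset {x. Q (mset x) \<and> sorted x} {M. Q M}"
  by (rule bij_betw_byWitness[where f' = sorted_list_of_multiset])
     (auto simp: sorted_sort_id)

text \<open>A sorted list of pairs is a word of type \<open>m\<close> cut into consecutive sorted blocks, the
  first component naming the block of a letter.\<close>

lemma h_part_mset_type:
  fixes m :: "'l::linorder multiset"
  shows "h_part (mset_type m) \<alpha> = real (card {x :: (nat \<times> 'l) list.
    mset (map snd x) = m \<and> count (mset (map fst x)) = \<alpha> \<and> sorted x})"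
proof (cases "fin_supp \<alpha>")
  case True
  let ?B = "\<lambda>l. {\<beta>. fin_supp \<beta> \<and> deg \<beta> = count m l}"
  have "h_part (mset_type m) \<alpha> = sf_prod_list (map (\<lambda>l \<beta>. if \<beta> \<in> ?B l then 1 else 0) (letters m)) \<alpha>"
    unfolding h_part_def mset_type_def map_map
    by (rule arg_cong[where f="\<lambda>fs. sf_prod_list fs \<alpha>"]) (simp add: fun_eq_iff h_sf_def)
  also have "\<dots> = real (card (exp_matrices ?B (set_mset m) \<alpha>))"
    using sf_prod_list_indicators[OF True distinct_letters, of ?B m] by (simp add: set_letters)
  also have "\<dots> = real (card {M :: (nat \<times> 'l) multiset. image_mset snd M = m \<and> count (image_mset fst M) = \<alpha>})"
    using bij_betw_same_card[OF exp_matrices_mset[OF True, of m]] by simp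
  also have "\<dots> = real (card {x :: (nat \<times> 'l) list.
    (mset (map snd x) = m \<and> count (mset (map fst x)) = \<alpha>) \<and> sorted x})"
    using bij_betw_same_card[OF bij_betw_mset_sorted[where
        Q="\<lambda>M :: (nat \<times> 'l) multiset. image_mset snd M = m \<and> count (image_mset fst M) = \<alpha>"]] by simp
  finally show ?thesis by (simp add: conj_assoc)
next
  case False
  then have "count (mset (map fst x)) \<noteq> \<alpha>" for x :: "(nat \<times> 'l) list"
    using fin_supp_count by blast
  then show ?thesis using sf_prod_list_not_fin_supp[OF False] by (simp add: h_part_def)
qed

lemma strict_sorted_iff_count:
  fixes x :: "'b::linorder list"
  shows "sorted_wrt (<) x \<longleftrightarrow> sorted x \<and> (\<forall>a. count (mset x) a \<le> 1)"
proof -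
  have "distinct x \<longleftrightarrow> (\<forall>a. count (mset x) a \<le> 1)"
    by (induction x) (auto simp: count_eq_zero_iff le_Suc_eq split: if_splits)
  then show ?thesis by (auto simp: strict_sorted_iff)
qed

text \<open>The tables for e have entries at most 1, so they are the multisets of pairs without
  repetition, and sorting such a multiset gives a strictly increasing list.\<close>

lemma e_part_mset_type:
  fixes m :: "'l::linorder multiset"
  shows "e_part (mset_type m) \<alpha> = real (card {x :: (nat \<times> 'l) list.
    mset (map snd x) = m \<and> count (mset (map fst x)) = \<alpha> \<and> sorted_wrt (<) x})"
proof (cases "fin_supp \<alpha>")
  case True
  let ?B = "\<lambda>l. {\<beta>. fin_supp \<beta> \<and> deg \<beta> = count m l}"
  let ?B1 = "\<lambda>l. {\<beta>. fin_supp \<beta> \<and> deg \<beta> = count m l \<and> (\<forall>i. \<beta> i \<le> 1)}"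
  let ?X = "{M :: (nat \<times> 'l) multiset. image_mset snd M = m \<and> count (image_mset fst M) = \<alpha>}"
  have "e_part (mset_type m) \<alpha> = sf_prod_list (map (\<lambda>l \<beta>. if \<beta> \<in> ?B1 l then 1 else 0) (letters m)) \<alpha>"
    unfolding e_part_def mset_type_def map_map
    by (rule arg_cong[where f="\<lambda>fs. sf_prod_list fs \<alpha>"]) (simp add: fun_eq_iff e_sf_def)
  also have "\<dots> = real (card (exp_matrices ?B1 (set_mset m) \<alpha>))"
    using sf_prod_list_indicators[OF True distinct_letters, of ?B1 m] by (simp add: set_letters)
  also have "\<dots> = real (card {M \<in> ?X. \<forall>a. count M a \<le> 1})"
  proof -
    have "bij_betw (\<lambda>M l i. count M (i, l)) {M \<in> ?X. \<forall>a. count M a \<le> 1} (exp_matrices ?B1 (set_mset m) \<alpha>)"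
    proof (rule bij_betw_subset[OF exp_matrices_mset[OF True, of m]])
      show "(\<lambda>M l i. count M (i, l)) ` {M \<in> ?X. \<forall>a. count M a \<le> 1} = exp_matrices ?B1 (set_mset m) \<alpha>"
      proof -
        \<comment> \<open>Rows outside the letters of \<open>m\<close> are zero, so bounding the
          rows of letters bounds every entry.\<close>
        have "exp_matrices ?B1 (set_mset m) \<alpha> =
            {b \<in> exp_matrices ?B (set_mset m) \<alpha>. \<forall>l i. b l i \<le> 1}"
        proof (intro equalityI subsetI)
          fix b assume b: "b \<in> exp_matrices ?B1 (set_mset m) \<alpha>"
          have "b l i \<le> 1" for l i
            using b by (cases "l \<in># m") (auto simp: exp_matrices_def)
          then show "b \<in> {b \<in> exp_matrices ?B (set_mset m) \<alpha>. \<forall>l i. b l i \<le> 1}"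
            using b by (auto simp: exp_matrices_def)
        qed (auto simp: exp_matrices_def)
        also have "\<dots> = {b \<in> (\<lambda>M l i. count M (i, l)) ` ?X. \<forall>l i. b l i \<le> 1}"
          using bij_betw_imp_surj_on[OF exp_matrices_mset[OF True, of m]] by simp
        also have "\<dots> = (\<lambda>M l i. count M (i, l)) ` {M \<in> ?X. \<forall>a. count M a \<le> 1}"
          by auto
        finally show ?thesis by simp
      qed
    qed auto
    then show ?thesis using bij_betw_same_card by fastforce
  qed
  also have "\<dots> = real (card {x :: (nat \<times> 'l) list.
    (mset x \<in> ?X \<and> (\<forall>a. count (mset x) a \<le> 1)) \<and> sorted x})"
    using bij_betw_same_card[OF bij_betw_mset_sorted[where
        Q="\<lambda>M :: (nat \<times> 'l) multiset. M \<in> ?X \<and> (\<forall>a. count M a \<le> 1)"]] by simp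
  also have "{x :: (nat \<times> 'l) list. (mset x \<in> ?X \<and> (\<forall>a. count (mset x) a \<le> 1)) \<and> sorted x} =
    {x :: (nat \<times> 'l) list. mset (map snd x) = m \<and> count (mset (map fst x)) = \<alpha> \<and> sorted_wrt (<) x}"
    unfolding strict_sorted_iff_count by auto
  finally show ?thesis .
next
  case False
  then have "count (mset (map fst x)) \<noteq> \<alpha>" for x :: "(nat \<times> 'l) list"
    using fin_supp_count by blast
  then show ?thesis using sf_prod_list_not_fin_supp[OF False] by (simp add: e_part_def)
qed

subsection \<open>Linear independence of the elementary products\<close>

text \<open>The conjugate partition, used as the exponent of the leading monomial of
  \<open>e_part \<mu>\<close>.\<close>

definition conj_exp :: "nat list \<Rightarrow> nat \<Rightarrow> nat" where
  "conj_exp \<mu> i = length (filter (\<lambda>k. i < k) \<mu>)"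

text \<open>Both sides count the cells in the first \<open>r\<close> columns of the Young diagram of
  \<mu>.\<close>

lemma sum_conj_exp: "(\<Sum>i<r. conj_exp \<mu> i) = (\<Sum>j<length \<mu>. min r (\<mu> ! j))"
proof -
  have "(\<Sum>i<r. conj_exp \<mu> i) = (\<Sum>i<r. \<Sum>j<length \<mu>. if i < \<mu> ! j then 1 else 0)"
    by (simp add: conj_exp_def length_filter_conv_card sum.If_cases Int_def conj_commute)
  also have "\<dots> = (\<Sum>j<length \<mu>. \<Sum>i<r. if i < \<mu> ! j then 1 else 0)"
    by (rule sum.swap)
  also have "\<dots> = (\<Sum>j<length \<mu>. min r (\<mu> ! j))"
  proof (rule sum.cong[OF refl])
    fix j
    have "{..<r} \<inter> {i. i < \<mu> ! j} = {..<min r (\<mu> ! j)}" by auto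
    then show "(\<Sum>i<r. if i < \<mu> ! j then 1 else 0) = min r (\<mu> ! j)"
      by (simp add: sum.If_cases)
  qed
  finally show ?thesis .
qed

text \<open>The conjugate records how many parts exceed each \<open>i\<close>, and consecutive
  differences give the multiplicities of the positive parts; parts 0 are excluded by
  \<open>is_partition\<close>.\<close>

lemma conj_exp_inject:
  assumes "is_partition n \<mu>" "is_partition n' \<nu>" "conj_exp \<mu> = conj_exp \<nu>"
  shows "\<mu> = \<nu>"
proof -
  have count: "count (mset \<kappa>) (Suc i) = conj_exp \<kappa> i - conj_exp \<kappa> (Suc i)" for \<kappa> i
  proof -
    have "conj_exp \<kappa> i = conj_exp \<kappa> (Suc i) + count (mset \<kappa>) (Suc i)"
      unfolding conj_exp_def by (induction \<kappa>) auto
    then show ?thesis by simp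
  qed
  have "mset \<mu> = mset \<nu>"
  proof (rule multiset_eqI)
    fix k
    show "count (mset \<mu>) k = count (mset \<nu>) k"
    proof (cases k)
      case 0
      have "0 \<notin># mset \<mu>" "0 \<notin># mset \<nu>" using assms(1,2) by (auto simp: is_partition_def)
      then show ?thesis using 0 by (simp only: not_in_iff)
    next
      case (Suc i)
      then show ?thesis using assms(3) by (simp add: count)
    qed
  qed
  have "sort \<mu> = rev \<mu>"
    by (rule properties_for_sort) (use assms(1) in \<open>auto simp: is_partition_def sorted_wrt_rev\<close>)
  moreover have "sort \<mu> = rev \<nu>"
    by (rule properties_for_sort)
       (use assms(2) \<open>mset \<mu> = mset \<nu>\<close> in \<open>auto simp: is_partition_def sorted_wrt_rev\<close>)
  ultimately have "rev \<mu> = rev \<nu>" by simp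
  then show ?thesis by simp
qed

lemma finite_partitions: "finite (partitions n)"
proof (rule finite_subset)
  show "partitions n \<subseteq> {xs. set xs \<subseteq> {..n} \<and> length xs \<le> n}"
  proof
    fix \<mu> assume "\<mu> \<in> partitions n"
    then have pos: "\<forall>x\<in>set \<mu>. 0 < x" and sum: "sum_list \<mu> = n"
      by (auto simp: partitions_def is_partition_def)
    have "length \<mu> \<le> sum_list \<mu>" using pos by (induction \<mu>) auto
    moreover have "x \<le> n" if "x \<in> set \<mu>" for x using member_le_sum_list[OF that] sum by simp
    ultimately show "\<mu> \<in> {xs. set xs \<subseteq> {..n} \<and> length xs \<le> n}" using sum by auto
  qed
qed (rule finite_lists_length_le, simp)

text \<open>Rows are indexed by positions in \<mu>, since equal parts must keep separate
  rows.\<close>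

lemma e_part_exp_matrices:
  assumes "fin_supp \<alpha>"
  shows "e_part \<mu> \<alpha> = real (card (exp_matrices
    (\<lambda>j. {\<beta>. fin_supp \<beta> \<and> deg \<beta> = \<mu> ! j \<and> (\<forall>i. \<beta> i \<le> 1)}) {..<length \<mu>} \<alpha>))"
proof -
  let ?B = "\<lambda>j. {\<beta>. fin_supp \<beta> \<and> deg \<beta> = \<mu> ! j \<and> (\<forall>i. \<beta> i \<le> 1)}"
  have "map e_sf \<mu> = map (\<lambda>j \<beta>. if \<beta> \<in> ?B j then 1 else 0) [0..<length \<mu>]"
    by (rule nth_equalityI) (auto simp: e_sf_def fun_eq_iff)
  then show ?thesis
    using sf_prod_list_indicators[OF assms distinct_upt, of ?B 0 "length \<mu>"]
    by (simp add: e_part_def atLeast0LessThan)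
qed

text \<open>A 0-1 row with sum \<open>\<mu> ! j\<close> contributes at most
  \<open>min r (\<mu> ! j)\<close> to the first \<open>r\<close> columns; summing over the rows
  gives the bound.\<close>

lemma e_part_dominance:
  assumes "e_part \<mu> \<alpha> \<noteq> 0"
  shows "(\<Sum>i<r. \<alpha> i) \<le> (\<Sum>i<r. conj_exp \<mu> i)"
proof -
  let ?B = "\<lambda>j. {\<beta>. fin_supp \<beta> \<and> deg \<beta> = \<mu> ! j \<and> (\<forall>i. \<beta> i \<le> 1)}"
  have "fin_supp \<alpha>" using assms sf_prod_list_not_fin_supp by (auto simp: e_part_def)
  then have "exp_matrices ?B {..<length \<mu>} \<alpha> \<noteq> {}"
    using assms e_part_exp_matrices by force
  then obtain b where b: "b \<in> exp_matrices ?B {..<length \<mu>} \<alpha>" by blast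
  have "(\<Sum>i<r. \<alpha> i) = (\<Sum>i<r. \<Sum>j<length \<mu>. b j i)"
    using b by (simp add: exp_matrices_def)
  also have "\<dots> = (\<Sum>j<length \<mu>. \<Sum>i<r. b j i)" by (rule sum.swap)
  also have "\<dots> \<le> (\<Sum>j<length \<mu>. min r (\<mu> ! j))"
  proof (rule sum_mono)
    fix j assume "j \<in> {..<length \<mu>}"
    then have bj: "fin_supp (b j)" "deg (b j) = \<mu> ! j" "\<And>i. b j i \<le> 1"
      using b by (auto simp: exp_matrices_def)
    have "(\<Sum>i<r. b j i) \<le> (\<Sum>i<r. 1)" by (rule sum_mono) (rule bj)
    moreover have "(\<Sum>i<r. b j i) \<le> deg (b j)"
    proof -
      have "(\<Sum>i<r. b j i) = (\<Sum>i\<in>{..<r} \<inter> {i. b j i \<noteq> 0}. b j i)"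
        by (rule sum.mono_neutral_right) auto
      also have "\<dots> \<le> deg (b j)"
        unfolding deg_def by (rule sum_mono2) (use bj(1) in \<open>auto simp: fin_supp_def\<close>)
      finally show ?thesis .
    qed
    ultimately show "(\<Sum>i<r. b j i) \<le> min r (\<mu> ! j)" using bj(2) by simp
  qed
  finally show ?thesis by (simp add: sum_conj_exp)
qed

lemma fin_supp_conj_exp: "fin_supp (conj_exp \<mu>)"
proof -
  have "{i. conj_exp \<mu> i \<noteq> 0} \<subseteq> {..<sum_list \<mu>}"
  proof
    fix i assume "i \<in> {i. conj_exp \<mu> i \<noteq> 0}"
    then obtain k where "k \<in> set \<mu>" "i < k" by (auto simp: conj_exp_def filter_empty_conv)
    then show "i \<in> {..<sum_list \<mu>}" using member_le_sum_list[of k \<mu>] by simp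
  qed
  then show ?thesis unfolding fin_supp_def by (rule finite_subset) simp
qed

lemma e_part_conj_exp: "e_part \<mu> (conj_exp \<mu>) \<noteq> 0"
proof -
  let ?B = "\<lambda>j. {\<beta>. fin_supp \<beta> \<and> deg \<beta> = \<mu> ! j \<and> (\<forall>i. \<beta> i \<le> 1)}"
  let ?M = "exp_matrices ?B {..<length \<mu>} (conj_exp \<mu>)"
  have supp: "{i. i < k} = {..<k}" "fin_supp (\<lambda>i. if i < k then 1 else 0)"
    "deg (\<lambda>i. if i < k then 1 else 0) = k" for k :: nat
    by (auto simp: fin_supp_def deg_def)
  have "(\<Sum>j<length \<mu>. if j < length \<mu> \<and> i < \<mu> ! j then 1 else 0) = conj_exp \<mu> i" for i
    by (auto simp: conj_exp_def length_filter_conv_card sum.If_cases intro!: arg_cong[where f=card])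
  \<comment> \<open>The witness table is the Young diagram of \<mu> itself, left-justified in each
    row.\<close>
  then have "(\<lambda>j i. if j < length \<mu> \<and> i < \<mu> ! j then 1 else 0) \<in> ?M"
    by (auto simp: exp_matrices_def supp)
  moreover have "finite ?M" by (rule finite_exp_matrices) (simp_all add: fin_supp_conj_exp)
  ultimately show ?thesis
    unfolding e_part_exp_matrices[OF fin_supp_conj_exp] by auto
qed

text \<open>Triangularity: \<open>e_part \<mu>\<close> has its dominance-largest exponent at the conjugate of \<open>\<mu>\<close>.\<close>

lemma e_part_linear_independent:
  assumes zero: "\<And>\<alpha>. (\<Sum>\<mu>\<in>partitions n. c \<mu> * e_part \<mu> \<alpha>) = 0"
    and "\<mu> \<in> partitions n"
  shows "c \<mu> = 0"
proof (rule ccontr)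
  assume "c \<mu> \<noteq> 0"
  define C where "C = {\<mu> \<in> partitions n. c \<mu> \<noteq> 0}"
  \<comment> \<open>Partial sums turn dominance into the pointwise order of functions, in which a
    finite nonempty set has a maximal element.\<close>
  define D where "D = (\<lambda>\<mu> r. \<Sum>i<r. conj_exp \<mu> i)"
  have "finite (D ` C)" "D ` C \<noteq> {}"
    using assms(2) \<open>c \<mu> \<noteq> 0\<close> finite_partitions[of n] by (auto simp: C_def)
  then obtain d where "d \<in> D ` C" and max: "\<And>d'. d' \<in> D ` C \<Longrightarrow> d \<le> d' \<Longrightarrow> d = d'"
    by (meson finite_has_maximal)
  then obtain \<nu> where \<nu>: "\<nu> \<in> C" "d = D \<nu>" by blast
  have D_inj: "\<kappa> = \<nu>" if "\<kappa> \<in> C" "D \<nu> = D \<kappa>" for \<kappa>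
  proof (rule conj_exp_inject)
    show "conj_exp \<kappa> = conj_exp \<nu>"
    proof
      fix i
      have "D \<kappa> (Suc i) = D \<nu> (Suc i)" "D \<kappa> i = D \<nu> i" using that by simp_all
      then show "conj_exp \<kappa> i = conj_exp \<nu> i" by (simp add: D_def)
    qed
  qed (use \<nu> that in \<open>auto simp: C_def partitions_def\<close>)
  \<comment> \<open>At the leading exponent of the maximal \<nu>, a surviving term \<kappa> would
    dominate \<nu>, hence coincide with it.\<close>
  have "c \<kappa> * e_part \<kappa> (conj_exp \<nu>) = 0" if "\<kappa> \<in> partitions n - {\<nu>}" for \<kappa>
  proof (rule ccontr)
    assume "c \<kappa> * e_part \<kappa> (conj_exp \<nu>) \<noteq> 0"
    then have "\<kappa> \<in> C" "D \<nu> \<le> D \<kappa>"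
      using that e_part_dominance[of \<kappa> "conj_exp \<nu>"] by (auto simp: C_def D_def le_fun_def)
    moreover from this have "D \<nu> = D \<kappa>" using max[of "D \<kappa>"] \<nu>(2) by simp
    ultimately show False using D_inj[of \<kappa>] that by blast
  qed
  then have "(\<Sum>\<kappa>\<in>partitions n - {\<nu>}. c \<kappa> * e_part \<kappa> (conj_exp \<nu>)) = 0"
    by (rule sum.neutral[OF ballI])
  then have "(\<Sum>\<kappa>\<in>partitions n. c \<kappa> * e_part \<kappa> (conj_exp \<nu>)) = c \<nu> * e_part \<nu> (conj_exp \<nu>)"
    using sum.remove[OF finite_partitions[of n], of \<nu> "\<lambda>\<kappa>. c \<kappa> * e_part \<kappa> (conj_exp \<nu>)"] \<nu>(1)
    by (simp add: C_def)
  then show False using zero[of "conj_exp \<nu>"] e_part_conj_exp[of \<nu>] \<nu>(1) by (auto simp: C_def)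
qed

text \<open>By independence the series forces the coefficients on \<open>partitions n\<close>, so
  the description in \<open>omega\<close> singles out one series.\<close>

lemma omega_e_expansion:
  "omega n (\<lambda>\<alpha>. \<Sum>\<mu>\<in>partitions n. c \<mu> * e_part \<mu> \<alpha>) =
    (\<lambda>\<alpha>. \<Sum>\<mu>\<in>partitions n. c \<mu> * h_part \<mu> \<alpha>)"
  unfolding omega_def
proof (rule the_equality)
  show "\<exists>c'. (\<lambda>\<alpha>. \<Sum>\<mu>\<in>partitions n. c \<mu> * e_part \<mu> \<alpha>) =
      (\<lambda>\<alpha>. \<Sum>\<mu>\<in>partitions n. c' \<mu> * e_part \<mu> \<alpha>) \<and>
      (\<lambda>\<alpha>. \<Sum>\<mu>\<in>partitions n. c \<mu> * h_part \<mu> \<alpha>) =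
      (\<lambda>\<alpha>. \<Sum>\<mu>\<in>partitions n. c' \<mu> * h_part \<mu> \<alpha>)" by blast
next
  fix g
  assume "\<exists>c'. (\<lambda>\<alpha>. \<Sum>\<mu>\<in>partitions n. c \<mu> * e_part \<mu> \<alpha>) =
      (\<lambda>\<alpha>. \<Sum>\<mu>\<in>partitions n. c' \<mu> * e_part \<mu> \<alpha>) \<and>
      g = (\<lambda>\<alpha>. \<Sum>\<mu>\<in>partitions n. c' \<mu> * h_part \<mu> \<alpha>)"
  then obtain c' where c': "\<And>\<alpha>. (\<Sum>\<mu>\<in>partitions n. c \<mu> * e_part \<mu> \<alpha>) =
      (\<Sum>\<mu>\<in>partitions n. c' \<mu> * e_part \<mu> \<alpha>)"
    and g: "g = (\<lambda>\<alpha>. \<Sum>\<mu>\<in>partitions n. c' \<mu> * h_part \<mu> \<alpha>)" by (auto dest: fun_cong)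
  have "(\<Sum>\<mu>\<in>partitions n. (c \<mu> - c' \<mu>) * e_part \<mu> \<alpha>) = 0" for \<alpha>
    using c'[of \<alpha>] by (simp add: left_diff_distrib sum_subtractf)
  then have "c \<mu> - c' \<mu> = 0" if "\<mu> \<in> partitions n" for \<mu>
    using e_part_linear_independent[where c = "\<lambda>\<mu>. c \<mu> - c' \<mu>"] that by blast
  then show "g = (\<lambda>\<alpha>. \<Sum>\<mu>\<in>partitions n. c \<mu> * h_part \<mu> \<alpha>)"
    unfolding g by (intro ext sum.cong) auto
qed

subsection \<open>Frobenius characteristic of a rearrangement representation\<close>

lemma perm_orbit_self: "i \<in> perm_orbit \<pi> i"
  unfolding perm_orbit_def by (rule CollectI, rule exI[of _ 0]) simp

lemma perm_orbit_subset: "j \<in> perm_orbit \<pi> i \<Longrightarrow> perm_orbit \<pi> j \<subseteq> perm_orbit \<pi> i"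
proof
  fix x assume "j \<in> perm_orbit \<pi> i" "x \<in> perm_orbit \<pi> j"
  then obtain k l where "j = (\<pi> ^^ k) i" "x = (\<pi> ^^ l) j" by (auto simp: perm_orbit_def)
  then have "x = (\<pi> ^^ (l + k)) i" by (simp add: funpow_add)
  then show "x \<in> perm_orbit \<pi> i" by (auto simp: perm_orbit_def)
qed

text \<open>Orbits use only forward iterates; since \<pi> has finite order \<open>m\<close>, the
  iterate \<open>m * k - k\<close> undoes the iterate \<open>k\<close>.\<close>

lemma perm_orbit_sym:
  assumes "\<pi> permutes S" "finite S" "j \<in> perm_orbit \<pi> i"
  shows "i \<in> perm_orbit \<pi> j"
proof -
  obtain k where k: "j = (\<pi> ^^ k) i" using assms(3) by (auto simp: perm_orbit_def)
  obtain m where m: "\<pi> ^^ m = id" "m > 0"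
    using permutation_is_nilpotent[of \<pi>] assms(1,2) by (auto simp: permutation_permutes)
  have "\<pi> ^^ (m * k) = id" using m(1) by (simp add: funpow_mult[symmetric] id_funpow)
  moreover have "m * k = (m * k - k) + k" using m(2) by simp
  ultimately have "(\<pi> ^^ (m * k - k)) j = i" using k by (metis comp_apply funpow_add id_apply)
  then show ?thesis by (auto simp: perm_orbit_def)
qed

lemma perm_orbit_eq:
  assumes "\<pi> permutes S" "finite S" "j \<in> perm_orbit \<pi> i"
  shows "perm_orbit \<pi> j = perm_orbit \<pi> i"
  using perm_orbit_subset[OF assms(3)] perm_orbit_subset[OF perm_orbit_sym[OF assms]] by blast

lemma perm_orbit_subset_domain:
  assumes "\<pi> permutes S" "i \<in> S"
  shows "perm_orbit \<pi> i \<subseteq> S"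
proof -
  have "(\<pi> ^^ k) i \<in> S" for k
    using assms by (induction k) (auto simp: permutes_in_image)
  then show ?thesis by (auto simp: perm_orbit_def)
qed

lemma permute_list_fixed_iff:
  "permute_list \<pi> g = g \<longleftrightarrow> (\<forall>i<length g. g ! \<pi> i = g ! i)"
  unfolding list_eq_iff_nth_eq[of "permute_list \<pi> g"] by (auto simp: permute_list_def)

lemma permute_list_fixed_orbit:
  assumes \<pi>: "\<pi> permutes {..<length g}" and "permute_list \<pi> g = g" "i < length g" "j \<in> perm_orbit \<pi> i"
  shows "g ! j = g ! i"
proof -
  have "(\<pi> ^^ k) i < length g \<and> g ! ((\<pi> ^^ k) i) = g ! i" for k
  proof (induction k)
    case (Suc k)
    then show ?case
      using assms(2) permute_list_fixed_iff[of \<pi> g] permutes_in_image[OF \<pi>] by auto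
  qed (use assms in simp)
  then show ?thesis using assms(4) by (auto simp: perm_orbit_def)
qed

lemma count_mset_nth: "count (mset g) i = card {x. x < length g \<and> g ! x = i}"
  by (simp add: count_mset count_list_eq_length_filter length_filter_conv_card eq_commute)

text \<open>Listing the orbits themselves, in the order of \<open>cycle_type\<close>, gives distinct
  indices even when several cycles have the same length.\<close>

lemma cycle_type_orbit_list:
  obtains os where "distinct os" "set os = perm_orbit \<pi> ` {..<n}" "cycle_type n \<pi> = map card os"
proof -
  let ?Os = "perm_orbit \<pi> ` {..<n}"
  obtain l where l: "set l = ?Os" "distinct l" using finite_distinct_list[of ?Os] by auto
  define os where "os = rev (sort_key card l)"
  have "mset (map card (sort_key card l)) = image_mset card (mset_set ?Os)"
    using l by (simp add: mset_set_set[symmetric])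
  moreover have "sorted (map card (sort_key card l))" by simp
  ultimately have "sorted_list_of_multiset (image_mset card (mset_set ?Os)) = map card (sort_key card l)"
    by (metis sorted_list_of_multiset_mset sorted_sort_id)
  then have "cycle_type n \<pi> = map card os" by (simp add: cycle_type_def os_def rev_map)
  moreover have "distinct os" "set os = ?Os" using l by (simp_all add: os_def)
  ultimately show ?thesis using that by blast
qed

text \<open>A colouring fixed by \<pi> is constant on each orbit, so the row of an orbit
  \<open>q\<close> has the single entry \<open>card q\<close> in the column of its colour: one
  monomial of \<open>p_sf (card q)\<close>. Column sums count the positions of each colour.\<close>

lemma bij_betw_fixed_colourings:
  assumes \<pi>: "\<pi> permutes {..<n}"
  defines "Os \<equiv> perm_orbit \<pi> ` {..<n}"
  shows "bij_betw (\<lambda>g q i. if q \<in> Os then card {x \<in> q. g ! x = i} else 0)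
    {g :: nat list. length g = n \<and> count (mset g) = \<alpha> \<and> permute_list \<pi> g = g}
    (exp_matrices (\<lambda>q. {\<beta>. \<exists>i. \<beta> = (\<lambda>j. if j = i then card q else 0)}) Os \<alpha>)"
    (is "bij_betw ?G ?X ?Y")
proof -
  have sub: "q \<subseteq> {..<n}" if "q \<in> Os" for q
    using that perm_orbit_subset_domain[OF \<pi>] by (auto simp: Os_def)
  have fino: "finite q" if "q \<in> Os" for q using sub[OF that] finite_subset by blast
  have eqo: "q = perm_orbit \<pi> x" if "q \<in> Os" "x \<in> q" for q x
    using that perm_orbit_eq[OF \<pi>, of x] by (auto simp: Os_def)
  have cover: "{..<n} = \<Union>Os"
    using sub perm_orbit_self by (fastforce simp: Os_def)
  have count: "(\<Sum>q\<in>Os. card {x \<in> q. g ! x = i}) = count (mset g) i" if "length g = n" for g :: "nat list" and i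
  proof -
    have "(\<Sum>q\<in>Os. card {x \<in> q. g ! x = i}) = card (\<Union>q\<in>Os. {x \<in> q. g ! x = i})"
    proof (rule card_UN_disjoint[symmetric])
      show "finite Os" by (simp add: Os_def)
      show "\<forall>q\<in>Os. \<forall>q'\<in>Os. q \<noteq> q' \<longrightarrow> {x \<in> q. g ! x = i} \<inter> {x \<in> q'. g ! x = i} = {}"
        using eqo by blast
    qed (use fino in auto)
    also have "(\<Union>q\<in>Os. {x \<in> q. g ! x = i}) = {x. x < length g \<and> g ! x = i}"
      using cover that by auto
    finally show ?thesis by (simp add: count_mset_nth)
  qed
  have const: "?G g q = (\<lambda>j. if j = g ! x then card q else 0)"
    if "length g = n" "permute_list \<pi> g = g" "q \<in> Os" "x \<in> q" for g :: "nat list" and q x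
  proof
    fix j
    have "g ! y = g ! x" if "y \<in> q" for y
      using that permute_list_fixed_orbit[of \<pi> g x y] \<open>length g = n\<close> \<open>permute_list \<pi> g = g\<close> \<pi>
        eqo[OF \<open>q \<in> Os\<close> \<open>x \<in> q\<close>] sub[OF \<open>q \<in> Os\<close>] \<open>x \<in> q\<close> by auto
    then have "{y \<in> q. g ! y = j} = (if j = g ! x then q else {})" by auto
    then show "?G g q j = (if j = g ! x then card q else 0)" using \<open>q \<in> Os\<close> by simp
  qed
  have orbO: "perm_orbit \<pi> x \<in> Os" if "x < n" for x using that by (simp add: Os_def)
  \<comment> \<open>A nonempty orbit gives a nonzero row, from which its colour can be read
    off.\<close>
  have pos: "card q > 0" if "q \<in> Os" for q
    using that fino[OF that] perm_orbit_self by (auto simp: Os_def card_gt_0_iff)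
  show ?thesis unfolding bij_betw_def
  proof
    show "inj_on ?G ?X"
    proof (rule inj_onI)
      fix g g' assume g: "g \<in> ?X" and g': "g' \<in> ?X" and eq: "?G g = ?G g'"
      show "g = g'"
      proof (rule nth_equalityI)
        fix x assume "x < length g"
        then have x: "x < n" using g by simp
        let ?q = "perm_orbit \<pi> x"
        have "(\<lambda>j. if j = g ! x then card ?q else 0) = (\<lambda>j. if j = g' ! x then card ?q else 0)"
          using const[of g ?q x] const[of g' ?q x] g g' orbO[OF x] perm_orbit_self[of x \<pi>] fun_cong[OF eq, of ?q]
          by simp
        from fun_cong[OF this, of "g ! x"] show "g ! x = g' ! x"
          using pos[OF orbO[OF x]] by (simp split: if_splits)
      qed (use g g' in simp)
    qed
    show "?G ` ?X = ?Y"
    proof (intro equalityI subsetI)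
      fix b assume "b \<in> ?G ` ?X"
      then obtain g where g: "g \<in> ?X" and b: "b = ?G g" by blast
      have "\<exists>i. b q = (\<lambda>j. if j = i then card q else 0)" if q: "q \<in> Os" for q
      proof -
        obtain x where x: "x \<in> q" using pos[OF q] by fastforce
        have "b q = (\<lambda>j. if j = g ! x then card q else 0)"
          unfolding b by (rule const) (use g x q in auto)
        then show ?thesis by blast
      qed
      moreover have "(\<Sum>q\<in>Os. b q i) = \<alpha> i" for i
        using count[of g i] g by (auto simp: b)
      ultimately show "b \<in> ?Y" by (simp add: exp_matrices_def b)
    next
      fix b assume b: "b \<in> ?Y"
      then have "\<forall>q\<in>Os. \<exists>i. b q = (\<lambda>j. if j = i then card q else 0)"
        by (simp add: exp_matrices_def)
      then obtain v where v: "\<And>q. q \<in> Os \<Longrightarrow> b q = (\<lambda>j. if j = v q then card q else 0)"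
        by metis
      define g where "g = map (\<lambda>x. v (perm_orbit \<pi> x)) [0..<n]"
      have len: "length g = n" by (simp add: g_def)
      have fixed: "permute_list \<pi> g = g"
      proof -
        have "g ! \<pi> i = g ! i" if "i < n" for i
        proof -
          have "\<pi> i \<in> perm_orbit \<pi> i" unfolding perm_orbit_def by (rule CollectI, rule exI[of _ 1]) simp
          then have "perm_orbit \<pi> (\<pi> i) = perm_orbit \<pi> i" by (rule perm_orbit_eq[OF \<pi>, rotated]) simp
          then show ?thesis using that permutes_in_image[OF \<pi>, of i] by (simp add: g_def)
        qed
        then show ?thesis using permute_list_fixed_iff[of \<pi> g] \<pi> len by simp
      qed
      have Gb: "?G g = b"
      proof
        fix q
        show "?G g q = b q"
        proof (cases "q \<in> Os")
          case True
          obtain x where x: "x \<in> q" using pos[OF True] by fastforce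
          have "g ! x = v q" using x sub[OF True] eqo[OF True x] by (auto simp: g_def)
          then show ?thesis using const[OF len fixed True x] v[OF True] by simp
        next
          case False
          then show ?thesis using b by (simp add: exp_matrices_def)
        qed
      qed
      have "count (mset g) = \<alpha>"
      proof
        fix i
        have "count (mset g) i = (\<Sum>q\<in>Os. ?G g q i)" using count[OF len, of i] by simp
        also have "\<dots> = (\<Sum>q\<in>Os. b q i)"
          by (intro sum.cong refl fun_cong[OF fun_cong[OF Gb]])
        also have "\<dots> = \<alpha> i" using b by (simp add: exp_matrices_def)
        finally show "count (mset g) i = \<alpha> i" .
      qed
      then show "b \<in> ?G ` ?X" using len fixed Gb by blast
    qed
  qed
qed

lemma p_part_cycle_type:
  assumes \<pi>: "\<pi> permutes {..<n}"
  shows "p_part (cycle_type n \<pi>) \<alpha> =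
    real (card {g :: nat list. length g = n \<and> count (mset g) = \<alpha> \<and> permute_list \<pi> g = g})"
proof (cases "fin_supp \<alpha>")
  case True
  let ?B = "\<lambda>q :: nat set. {\<beta>. \<exists>i. \<beta> = (\<lambda>j. if j = i then card q else 0)}"
  obtain os where os: "distinct os" "set os = perm_orbit \<pi> ` {..<n}" "cycle_type n \<pi> = map card os"
    by (rule cycle_type_orbit_list)
  have "p_part (cycle_type n \<pi>) \<alpha> = sf_prod_list (map (\<lambda>q \<beta>. if \<beta> \<in> ?B q then 1 else 0) os) \<alpha>"
    unfolding p_part_def os(3) map_map
    by (rule arg_cong[where f="\<lambda>fs. sf_prod_list fs \<alpha>"]) (simp add: fun_eq_iff p_sf_def)
  also have "\<dots> = real (card (exp_matrices ?B (set os) \<alpha>))"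
    by (rule sf_prod_list_indicators[OF True os(1)])
  finally show ?thesis
    using bij_betw_same_card[OF bij_betw_fixed_colourings[OF \<pi>, of \<alpha>]] os(2) by simp
next
  case False
  then have empty: "{g :: nat list. length g = n \<and> count (mset g) = \<alpha> \<and> permute_list \<pi> g = g} = {}"
    using fin_supp_count by blast
  show ?thesis
    unfolding empty using sf_prod_list_not_fin_supp[OF False] by (simp add: p_part_def)
qed

text \<open>Burnside's lemma: each rearrangement orbit contains exactly one sorted word.\<close>

lemma sum_card_fixed_words:
  fixes X :: "'b::linorder list set"
  assumes "finite X" and len: "\<And>x. x \<in> X \<Longrightarrow> length x = n"
    and closed: "\<And>x \<pi>. x \<in> X \<Longrightarrow> \<pi> permutes {..<n} \<Longrightarrow> permute_list \<pi> x \<in> X"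
  shows "(\<Sum>\<pi>\<in>{\<pi>. \<pi> permutes {..<n}}. card {x \<in> X. permute_list \<pi> x = x}) =
    fact n * card {x \<in> X. sorted x}"
proof -
  let ?S = "{\<pi>. \<pi> permutes {..<n}}"
  let ?K = "{x \<in> X. sorted x}"
  have "\<exists>\<sigma>. \<sigma> permutes {..<n} \<and> permute_list \<sigma> (sort x) = x" if "x \<in> X" for x
  proof -
    obtain p where "p permutes {..<length (sort x)}" "permute_list p (sort x) = x"
      using mset_eq_permutation[of x "sort x"] by auto
    then show ?thesis using len[OF that] by auto
  qed
  then obtain \<sigma> where \<sigma>: "\<And>x. x \<in> X \<Longrightarrow> \<sigma> x permutes {..<n}"
    "\<And>x. x \<in> X \<Longrightarrow> permute_list (\<sigma> x) (sort x) = x" by metis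
  have comp: "permute_list (f \<circ> g) x = permute_list g (permute_list f x)"
    if "x \<in> X" "g permutes {..<n}" for f g x
    using permute_list_compose[of g x f] len that by simp
  have sortX: "sort x \<in> X" if "x \<in> X" for x
  proof -
    obtain p where "p permutes {..<length x}" "permute_list p x = sort x"
      using mset_eq_permutation[of "sort x" x] by auto
    then show ?thesis using closed[OF that, of p] len[OF that] by auto
  qed
  have sort_perm: "sort (permute_list \<rho> k) = k" if "k \<in> ?K" "\<rho> permutes {..<n}" for \<rho> k
    by (rule properties_for_sort) (use that len[of k] in auto)
  \<comment> \<open>Orbit-stabiliser as a bijection: \<sigma> \<open>x\<close> is a chosen
    permutation from \<open>sort x\<close> to \<open>x\<close>, so as \<pi> runs over the
    permutations fixing \<open>x\<close>, the composite with \<sigma> \<open>x\<close> runs over all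
    permutations from \<open>sort x\<close> to \<open>x\<close>. Conversely a permutation \<rho> and
    a sorted word \<open>k\<close> determine \<open>x\<close> as the rearrangement of
    \<open>k\<close> by \<rho>.\<close>
  have "bij_betw (\<lambda>(\<pi>, x). (\<sigma> x \<circ> \<pi>, sort x))
    (SIGMA \<pi>:?S. {x \<in> X. permute_list \<pi> x = x}) (?S \<times> ?K)"
  proof (rule bij_betw_byWitness[where f' = "\<lambda>(\<rho>, k). (inv (\<sigma> (permute_list \<rho> k)) \<circ> \<rho>, permute_list \<rho> k)"])
    show "\<forall>p\<in>SIGMA \<pi>:?S. {x \<in> X. permute_list \<pi> x = x}.
      (\<lambda>(\<rho>, k). (inv (\<sigma> (permute_list \<rho> k)) \<circ> \<rho>, permute_list \<rho> k)) ((\<lambda>(\<pi>, x). (\<sigma> x \<circ> \<pi>, sort x)) p) = p"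
    proof clarify
      fix \<pi> x assume \<pi>: "\<pi> permutes {..<n}" and x: "x \<in> X" "permute_list \<pi> x = x"
      have "permute_list (\<sigma> x \<circ> \<pi>) (sort x) = x"
        using comp[OF sortX[OF x(1)] \<pi>] \<sigma>(2)[OF x(1)] x(2) by simp
      moreover have "inv (\<sigma> x) \<circ> (\<sigma> x \<circ> \<pi>) = \<pi>"
        using permutes_inv_o(2)[OF \<sigma>(1)[OF x(1)]] by (simp add: o_assoc)
      ultimately show "inv (\<sigma> (permute_list (\<sigma> x \<circ> \<pi>) (sort x))) \<circ> (\<sigma> x \<circ> \<pi>) = \<pi> \<and>
        permute_list (\<sigma> x \<circ> \<pi>) (sort x) = x" by simp
    qed
    show "\<forall>p\<in>?S \<times> ?K. (\<lambda>(\<pi>, x). (\<sigma> x \<circ> \<pi>, sort x))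
      ((\<lambda>(\<rho>, k). (inv (\<sigma> (permute_list \<rho> k)) \<circ> \<rho>, permute_list \<rho> k)) p) = p"
    proof clarify
      fix \<rho> k assume \<rho>: "\<rho> permutes {..<n}" and k: "k \<in> X" "sorted k"
      let ?x = "permute_list \<rho> k"
      have x: "?x \<in> X" by (rule closed[OF k(1) \<rho>])
      show "\<sigma> ?x \<circ> (inv (\<sigma> ?x) \<circ> \<rho>) = \<rho> \<and> sort ?x = k"
        using permutes_inv_o(1)[OF \<sigma>(1)[OF x]] sort_perm[OF _ \<rho>] k by (simp add: o_assoc)
    qed
    show "(\<lambda>(\<pi>, x). (\<sigma> x \<circ> \<pi>, sort x)) ` (SIGMA \<pi>:?S. {x \<in> X. permute_list \<pi> x = x}) \<subseteq> ?S \<times> ?K"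
      using \<sigma>(1) sortX by (auto intro: permutes_compose)
    show "(\<lambda>(\<rho>, k). (inv (\<sigma> (permute_list \<rho> k)) \<circ> \<rho>, permute_list \<rho> k)) ` (?S \<times> ?K) \<subseteq>
      (SIGMA \<pi>:?S. {x \<in> X. permute_list \<pi> x = x})"
    proof (rule image_subsetI)
      fix p assume "p \<in> ?S \<times> ?K"
      then obtain \<rho> k where p: "p = (\<rho>, k)" and \<rho>: "\<rho> permutes {..<n}" and k: "k \<in> X" "sorted k"
        by auto
      let ?x = "permute_list \<rho> k"
      let ?\<tau> = "inv (\<sigma> ?x)"
      have x: "?x \<in> X" by (rule closed[OF k(1) \<rho>])
      have \<tau>: "?\<tau> permutes {..<n}" using \<sigma>(1)[OF x] by (rule permutes_inv)
      have "permute_list ?\<tau> ?x = permute_list ?\<tau> (permute_list (\<sigma> ?x) k)"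
        using \<sigma>(2)[OF x] sort_perm[OF _ \<rho>] k by simp
      also have "\<dots> = k"
        using comp[OF k(1) \<tau>, of "\<sigma> ?x"] permutes_inv_o(1)[OF \<sigma>(1)[OF x]] by simp
      finally have "permute_list (?\<tau> \<circ> \<rho>) ?x = ?x" using comp[OF x \<rho>] by simp
      then show "(\<lambda>(\<rho>, k). (inv (\<sigma> (permute_list \<rho> k)) \<circ> \<rho>, permute_list \<rho> k)) p \<in>
          (SIGMA \<pi>:?S. {x \<in> X. permute_list \<pi> x = x})"
        using x permutes_compose[OF \<rho> \<tau>] by (simp add: p)
    qed
  qed
  from bij_betw_same_card[OF this] show ?thesis
    using assms(1) finite_permutations[of "{..<n}"]
    by (simp add: card_cartesian_product card_permutations)
qed

lemma finite_words_of_content: "finite {g. count (mset g) = \<alpha>}"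
proof (cases "{g. count (mset g) = \<alpha>} = {}")
  case False
  then obtain g0 where "count (mset g0) = \<alpha>" by blast
  then have "{g. count (mset g) = \<alpha>} = {g. mset g = mset g0}"
    by (auto simp: multiset_eq_iff fun_eq_iff)
  then show ?thesis using mset_eq_finite[of g0] by simp
qed simp

text \<open>The factor \<open>p_part\<close> counts fixed colourings, so each summand counts lists
  of pairs fixed by \<pi>; averaging over \<pi> leaves one sorted list per orbit. The colour is put
  first so that sorting groups letters by colour.\<close>

lemma frobenius_ch_words:
  fixes A :: "'l::linorder list set"
  assumes "finite A" and len: "\<And>w. w \<in> A \<Longrightarrow> length w = n"
    and closed: "\<And>w \<pi>. w \<in> A \<Longrightarrow> \<pi> permutes {..<n} \<Longrightarrow> permute_list \<pi> w \<in> A"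
  shows "frobenius_ch n (\<lambda>\<pi>. real (card {w \<in> A. permute_list \<pi> w = w})) \<alpha> =
    real (card {x :: (nat \<times> 'l) list. map snd x \<in> A \<and> count (mset (map fst x)) = \<alpha> \<and> sorted x})"
proof -
  define X where "X = {x :: (nat \<times> 'l) list. map snd x \<in> A \<and> count (mset (map fst x)) = \<alpha>}"
  have zipX: "bij_betw (\<lambda>(w, g). zip g w)
      ({w \<in> A. permute_list \<pi> w = w} \<times> {g. length g = n \<and> count (mset g) = \<alpha> \<and> permute_list \<pi> g = g})
      {x \<in> X. permute_list \<pi> x = x}" if \<pi>: "\<pi> permutes {..<n}" for \<pi>
  proof (rule bij_betw_byWitness[where f' = "\<lambda>x. (map snd x, map fst x)"])
    show "(\<lambda>x. (map snd x, map fst x)) ` {x \<in> X. permute_list \<pi> x = x} \<subseteq>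
      {w \<in> A. permute_list \<pi> w = w} \<times> {g. length g = n \<and> count (mset g) = \<alpha> \<and> permute_list \<pi> g = g}"
    proof (rule image_subsetI)
      fix x assume x: "x \<in> {x \<in> X. permute_list \<pi> x = x}"
      then have "length x = n" using len[of "map snd x"] by (simp add: X_def)
      then show "(map snd x, map fst x) \<in> {w \<in> A. permute_list \<pi> w = w} \<times>
          {g. length g = n \<and> count (mset g) = \<alpha> \<and> permute_list \<pi> g = g}"
        using x \<pi> permute_list_map[of \<pi> x snd] permute_list_map[of \<pi> x fst] by (simp add: X_def)
    qed
    show "(\<lambda>(w, g). zip g w) ` ({w \<in> A. permute_list \<pi> w = w} \<times>
        {g. length g = n \<and> count (mset g) = \<alpha> \<and> permute_list \<pi> g = g}) \<subseteq> {x \<in> X. permute_list \<pi> x = x}"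
      using len \<pi> by (auto simp: X_def permute_list_zip simp del: mset_map)
  qed (use len in \<open>auto simp: zip_map_fst_snd\<close>)
  have "finite X"
  proof (rule finite_subset)
    show "X \<subseteq> (\<lambda>(w, g). zip g w) ` (A \<times> {g. count (mset g) = \<alpha>})"
    proof
      fix x assume "x \<in> X"
      then show "x \<in> (\<lambda>(w, g). zip g w) ` (A \<times> {g. count (mset g) = \<alpha>})"
        by (intro image_eqI[where x="(map snd x, map fst x)"]) (auto simp: X_def zip_map_fst_snd)
    qed
  qed (use assms(1) finite_words_of_content in auto)
  have "(\<Sum>\<pi>\<in>{\<pi>. \<pi> permutes {..<n}}. real (card {w \<in> A. permute_list \<pi> w = w}) * p_part (cycle_type n \<pi>) \<alpha>) =
      (\<Sum>\<pi>\<in>{\<pi>. \<pi> permutes {..<n}}. real (card {x \<in> X. permute_list \<pi> x = x}))"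
    using bij_betw_same_card[OF zipX] by (intro sum.cong) (auto simp: p_part_cycle_type card_cartesian_product simp flip: of_nat_mult)
  also have "\<dots> = real (\<Sum>\<pi>\<in>{\<pi>. \<pi> permutes {..<n}}. card {x \<in> X. permute_list \<pi> x = x})"
    by simp
  also have "(\<Sum>\<pi>\<in>{\<pi>. \<pi> permutes {..<n}}. card {x \<in> X. permute_list \<pi> x = x}) = fact n * card {x \<in> X. sorted x}"
  proof (rule sum_card_fixed_words[OF \<open>finite X\<close>])
    fix x assume x: "x \<in> X"
    then show lx: "length x = n" using len[of "map snd x"] by (simp add: X_def)
    fix \<pi> assume \<pi>: "\<pi> permutes {..<n}"
    have "map snd (permute_list \<pi> x) = permute_list \<pi> (map snd x)"
      "map fst (permute_list \<pi> x) = permute_list \<pi> (map fst x)"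
      using \<pi> lx by (simp_all add: permute_list_map)
    then show "permute_list \<pi> x \<in> X"
      using x closed[of "map snd x" \<pi>] \<pi> lx mset_permute_list[of \<pi> "map fst x"] by (simp add: X_def)
  qed
  finally show ?thesis unfolding frobenius_ch_def X_def by (simp add: conj_assoc)
qed

subsection \<open>Ranked posets and labels of saturated chains\<close>

locale ranked =
  fixes P :: "'a set" and le :: "'a \<Rightarrow> 'a \<Rightarrow> bool" and rho :: "'a \<Rightarrow> nat"
    and n :: nat and z t :: 'a
  assumes ranked_poset: "ranked_poset P le rho n z t"
begin

abbreviation sat_chain :: "'a list \<Rightarrow> bool" where
  "sat_chain \<equiv> sat_chain_from_bot P le z"

abbreviation chains :: "'a list set" where
  "chains \<equiv> max_chains P le n z t"

lemma finite_P: "finite P"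
  and z_in: "z \<in> P" and t_in: "t \<in> P"
  and z_le: "x \<in> P \<Longrightarrow> le z x" and le_t: "x \<in> P \<Longrightarrow> le x t"
  and rho_z: "rho z = 0" and rho_t: "rho t = n"
  and rho_covers: "covers P le x y \<Longrightarrow> rho y = rho x + 1"
  and le_refl: "x \<in> P \<Longrightarrow> le x x"
  and le_antisym: "x \<in> P \<Longrightarrow> y \<in> P \<Longrightarrow> le x y \<Longrightarrow> le y x \<Longrightarrow> x = y"
  and le_trans: "x \<in> P \<Longrightarrow> y \<in> P \<Longrightarrow> w \<in> P \<Longrightarrow> le x y \<Longrightarrow> le y w \<Longrightarrow> le x w"
  using ranked_poset unfolding ranked_poset_def partial_order_on'_def by blast+

lemma covers_in: "covers P le x y \<Longrightarrow> x \<in> P \<and> y \<in> P \<and> le x y"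
  by (simp add: covers_def)

text \<open>Among the elements strictly above \<open>x\<close> and up to \<open>y\<close>, one with
  the fewest elements below it covers \<open>x\<close>.\<close>

lemma exists_cover:
  assumes "x \<in> P" "y \<in> P" "le x y" "x \<noteq> y"
  obtains w where "covers P le x w" "le w y"
proof -
  let ?S = "\<lambda>w. w \<in> P \<and> le x w \<and> x \<noteq> w \<and> le w y"
  let ?d = "\<lambda>w. card {v \<in> P. le v w}"
  have "?S y" using assms le_refl by simp
  from ex_has_least_nat[of ?S, OF this, of ?d]
  obtain w where w: "?S w" and min: "\<And>v. ?S v \<Longrightarrow> ?d w \<le> ?d v" by auto
  have "\<not> (\<exists>v\<in>P. le x v \<and> x \<noteq> v \<and> le v w \<and> v \<noteq> w)"
  proof
    assume "\<exists>v\<in>P. le x v \<and> x \<noteq> v \<and> le v w \<and> v \<noteq> w"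
    then obtain v where v: "v \<in> P" "le x v" "x \<noteq> v" "le v w" "v \<noteq> w" by blast
    have "{u \<in> P. le u v} \<subset> {u \<in> P. le u w}"
      using v w le_trans le_antisym le_refl by (intro psubsetI) blast+
    then have "?d v < ?d w" using finite_P by (intro psubset_card_mono) auto
    moreover have "?S v" using v w assms le_trans by blast
    ultimately show False using min[of v] by simp
  qed
  then have "covers P le x w" using w assms(1) by (auto simp: covers_def)
  then show ?thesis using that w by blast
qed

text \<open>The axioms compare ranks along covers, so strictness is obtained by climbing through a
  cover of \<open>x\<close>; the up-set of \<open>x\<close> shrinks at each step.\<close>

lemma rho_strict:
  assumes "x \<in> P" "y \<in> P" "le x y" "x \<noteq> y"
  shows "rho x < rho y"
  using assms
proof (induction "card {v \<in> P. le x v}" arbitrary: x rule: less_induct)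
  case less
  obtain w where w: "covers P le x w" "le w y"
    using exists_cover less.prems by blast
  have wP: "w \<in> P" "le x w" "x \<noteq> w" using w by (auto simp: covers_def)
  show ?case
  proof (cases "w = y")
    case True
    then show ?thesis using rho_covers[OF w(1)] by simp
  next
    case False
    have "{v \<in> P. le w v} \<subset> {v \<in> P. le x v}"
      using wP less.prems(1) le_trans le_antisym le_refl by (intro psubsetI) blast+
    then have "card {v \<in> P. le w v} < card {v \<in> P. le x v}"
      using finite_P by (intro psubset_card_mono) auto
    then have "rho w < rho y" using less.hyps wP w False less.prems by blast
    then show ?thesis using rho_covers[OF w(1)] by simp
  qed
qed

lemma rho_mono: "x \<in> P \<Longrightarrow> y \<in> P \<Longrightarrow> le x y \<Longrightarrow> rho x \<le> rho y"
  using rho_strict by (cases "x = y") (auto intro: less_imp_le)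

lemma sat_chain_z: "sat_chain [z]"
  by (simp add: sat_chain_from_bot_def)

lemma sat_chain_take:
  assumes "sat_chain ws" "0 < k"
  shows "sat_chain (take k ws)"
  using assms by (auto simp: sat_chain_from_bot_def)

lemma sat_chain_nth:
  assumes "sat_chain ws" "i < length ws"
  shows "ws ! i \<in> P \<and> rho (ws ! i) = i"
  using assms(2)
proof (induction i)
  case 0
  then show ?case using assms(1) z_in rho_z by (simp add: sat_chain_from_bot_def)
next
  case (Suc i)
  then have "covers P le (ws ! i) (ws ! (i + 1))"
    using assms(1) by (simp add: sat_chain_from_bot_def)
  then show ?case using rho_covers covers_in Suc by fastforce
qed

lemma sat_chain_nonempty: "sat_chain ws \<Longrightarrow> ws \<noteq> []"
  by (simp add: sat_chain_from_bot_def)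

lemma sat_chain_nth_0: "sat_chain ws \<Longrightarrow> ws ! 0 = z"
  by (simp add: sat_chain_from_bot_def)

lemma length_sat_chain:
  assumes "sat_chain ws"
  shows "length ws = Suc (rho (last ws))"
  using sat_chain_nth[OF assms, of "length ws - 1"] sat_chain_nonempty[OF assms]
  by (simp add: last_conv_nth)

lemma last_sat_chain_in:
  assumes "sat_chain ws"
  shows "last ws \<in> P"
  using sat_chain_nth[OF assms, of "length ws - 1"] sat_chain_nonempty[OF assms]
  by (simp add: last_conv_nth)

lemma sat_chain_le:
  assumes "sat_chain ws" "i \<le> j" "j < length ws"
  shows "le (ws ! i) (ws ! j)"
  using assms(2,3)
proof (induction j rule: dec_induct)
  case base
  then show ?case using sat_chain_nth[OF assms(1)] le_refl by blast
next
  case (step j)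
  have "covers P le (ws ! j) (ws ! (j + 1))"
    using assms(1) step.prems by (simp add: sat_chain_from_bot_def)
  then have cov: "ws ! j \<in> P" "ws ! Suc j \<in> P" "le (ws ! j) (ws ! Suc j)"
    using covers_in by simp_all
  have "ws ! i \<in> P" using sat_chain_nth[OF assms(1), of i] step by simp
  then show ?case
    using le_trans[of "ws ! i" "ws ! j" "ws ! Suc j"] cov step.IH step.prems by simp
qed

text \<open>The covering relations inside \<open>ws\<close> come from \<open>ws\<close> being
  saturated; those in \<open>completion\<close> start at the junction of \<open>ws\<close> and
  \<open>vs\<close>.\<close>

lemma sat_chain_append_iff_completion:
  assumes "sat_chain ws"
  shows "completion P le ws u vs \<longleftrightarrow> vs \<noteq> [] \<and> sat_chain (ws @ vs) \<and> last (ws @ vs) = u"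
proof
  assume c: "completion P le ws u vs"
  have "covers P le ((ws @ vs) ! i) ((ws @ vs) ! (i + 1))" if "i + 1 < length (ws @ vs)" for i
  proof (cases "length ws \<le> i + 1")
    case True
    then show ?thesis using c that by (simp add: completion_def)
  next
    case False
    then show ?thesis using assms by (simp add: sat_chain_from_bot_def nth_append)
  qed
  then show "vs \<noteq> [] \<and> sat_chain (ws @ vs) \<and> last (ws @ vs) = u"
    using c assms by (auto simp: completion_def sat_chain_from_bot_def nth_append)
next
  assume "vs \<noteq> [] \<and> sat_chain (ws @ vs) \<and> last (ws @ vs) = u"
  then show "completion P le ws u vs"
    by (auto simp: completion_def sat_chain_from_bot_def)
qed

lemma sat_chain_snoc:
  assumes "sat_chain ws" "covers P le (last ws) w"
  shows "sat_chain (ws @ [w])"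
proof -
  have "covers P le ((ws @ [w]) ! i) ((ws @ [w]) ! (i + 1))" if "i + 1 < length (ws @ [w])" for i
  proof (cases "i + 1 < length ws")
    case True
    then show ?thesis using assms(1) by (simp add: sat_chain_from_bot_def nth_append)
  next
    case False
    then have "i = length ws - 1" using that by simp
    then show ?thesis
      using assms(2) sat_chain_nonempty[OF assms(1)] by (simp add: nth_append last_conv_nth)
  qed
  then show ?thesis using assms(1) by (auto simp: sat_chain_from_bot_def nth_append)
qed

lemma sat_chain_extend:
  assumes "sat_chain ws" "u \<in> P" "le (last ws) u"
  obtains vs where "sat_chain (ws @ vs)" "last (ws @ vs) = u"
  using assms
proof (induction "rho u - rho (last ws)" arbitrary: ws thesis rule: less_induct)
  case less
  show ?case
  proof (cases "last ws = u")
    case True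
    then show ?thesis using less.prems(1)[of "[]"] less.prems(2) by simp
  next
    case False
    have wP: "last ws \<in> P" by (rule last_sat_chain_in[OF less.prems(2)])
    obtain w where w: "covers P le (last ws) w" "le w u"
      using exists_cover[OF wP less.prems(3,4) False] by blast
    have "rho u - rho w < rho u - rho (last ws)"
      using rho_covers[OF w(1)] rho_strict[OF wP less.prems(3,4) False] by simp
    then obtain vs where "sat_chain ((ws @ [w]) @ vs)" "last ((ws @ [w]) @ vs) = u"
      using less.hyps[of "ws @ [w]"] sat_chain_snoc[OF less.prems(2) w(1)] less.prems(3) w(2) by auto
    then show ?thesis using less.prems(1)[of "w # vs"] by simp
  qed
qed

text \<open>Ranks count the steps of a saturated chain, so ending in \<open>t\<close> forces the
  length \<open>n + 1\<close>.\<close>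

lemma chains_iff: "c \<in> chains \<longleftrightarrow> sat_chain c \<and> last c = t"
proof
  assume c: "c \<in> chains"
  then have "c \<noteq> []" by (auto simp: max_chains_def)
  then show "sat_chain c \<and> last c = t"
    using c by (auto simp: max_chains_def sat_chain_from_bot_def last_conv_nth)
next
  assume c: "sat_chain c \<and> last c = t"
  then have "length c = n + 1" using length_sat_chain[of c] rho_t by simp
  moreover have "c \<noteq> []" using c sat_chain_nonempty by blast
  ultimately show "c \<in> chains"
    using c by (auto simp: max_chains_def sat_chain_from_bot_def last_conv_nth)
qed

lemma length_chain: "c \<in> chains \<Longrightarrow> length c = n + 1"
  by (simp add: max_chains_def)

lemma finite_chains: "finite chains"
proof (rule finite_subset)
  show "chains \<subseteq> {xs. set xs \<subseteq> P \<and> length xs = n + 1}"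
    using sat_chain_nth length_chain by (auto simp: chains_iff in_set_conv_nth)
qed (rule finite_lists_length_eq[OF finite_P])

lemma extend_to_chain:
  assumes "sat_chain ws"
  obtains c where "c \<in> chains" "take (length ws) c = ws"
proof -
  obtain vs where "sat_chain (ws @ vs)" "last (ws @ vs) = t"
    using sat_chain_extend[OF assms t_in le_t[OF last_sat_chain_in[OF assms]]] by blast
  then show ?thesis using that[of "ws @ vs"] by (simp add: chains_iff)
qed

lemma length_sat_chain_le: "sat_chain ws \<Longrightarrow> length ws \<le> n + 1"
  by (metis extend_to_chain length_chain length_take min.cobounded2 min.commute)

text \<open>The multichain with \<open>z\<close> in front and continued by \<open>t\<close> forever,
  so that block \<open>i\<close> runs from point \<open>i\<close> to point \<open>Suc i\<close> for
  every \<open>i\<close> and later sums have no boundary cases.\<close>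

definition chain_point :: "'a list \<Rightarrow> nat \<Rightarrow> 'a" where
  "chain_point ts i = (if i \<le> length ts then (z # ts) ! i else t)"

context
  fixes ts
  assumes ts: "ts \<in> multichains P le t"
begin

lemma chain_point_in: "chain_point ts i \<in> P"
proof (cases i)
  case 0
  then show ?thesis using z_in by (simp add: chain_point_def)
next
  case (Suc j)
  then show ?thesis using ts t_in by (auto simp: chain_point_def multichains_def)
qed

lemma chain_point_le: "le (chain_point ts i) (chain_point ts (Suc i))"
proof (cases "Suc i \<le> length ts")
  case True
  show ?thesis
  proof (cases i)
    case 0
    then show ?thesis using z_le[OF chain_point_in[of 1]] by (simp add: chain_point_def)
  next
    case (Suc j)
    then show ?thesis
      using ts True by (auto simp: chain_point_def multichains_def successively_conv_nth)
  qed
next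
  case False
  then show ?thesis using le_t[OF chain_point_in[of i]] by (simp add: chain_point_def)
qed

lemma flag_exp_chain_point:
  "flag_exp rho z t ts i = rho (chain_point ts (Suc i)) - rho (chain_point ts i)"
  by (auto simp: flag_exp_def Let_def chain_point_def nth_append nth_Cons split: nat.split)

text \<open>Telescoping; monotone ranks make the natural subtraction exact.\<close>

lemma sum_flag_exp: "(\<Sum>i<j. flag_exp rho z t ts i) = rho (chain_point ts j)"
proof (induction j)
  case 0
  then show ?case using rho_z by (simp add: chain_point_def)
next
  case (Suc j)
  then show ?case
    using rho_mono[OF chain_point_in chain_point_in chain_point_le, of j]
    by (simp add: flag_exp_chain_point)
qed

lemma fin_supp_flag_exp: "fin_supp (flag_exp rho z t ts)"
proof -
  have "{i. flag_exp rho z t ts i \<noteq> 0} \<subseteq> {..length ts}"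
    by (auto simp: flag_exp_def Let_def split: if_splits)
  then show ?thesis unfolding fin_supp_def by (rule finite_subset) simp
qed

lemma deg_flag_exp: "deg (flag_exp rho z t ts) = n"
proof -
  have "deg (flag_exp rho z t ts) = (\<Sum>i<Suc (length ts). flag_exp rho z t ts i)"
    unfolding deg_def by (rule sum.mono_neutral_left) (auto simp: flag_exp_def Let_def split: if_splits)
  also have "\<dots> = n" using rho_t by (subst sum_flag_exp) (simp add: chain_point_def)
  finally show ?thesis .
qed

text \<open>The condition that the last element is not \<open>t\<close> enters here: the length of a
  multichain is the last index with nonzero exponent, and is thus recoverable from the
  monomial.\<close>

lemma flag_exp_last_pos:
  assumes "0 < n"
  shows "0 < flag_exp rho z t ts (length ts)"
proof -
  have "chain_point ts (length ts) \<noteq> t"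
  proof (cases "ts = []")
    case True
    then show ?thesis using assms rho_z rho_t by (auto simp: chain_point_def)
  next
    case False
    then have "chain_point ts (length ts) = last ts"
      by (simp add: chain_point_def last_conv_nth nth_Cons')
    then show ?thesis using ts False by (simp add: multichains_def)
  qed
  then have "rho (chain_point ts (length ts)) < n"
    using rho_strict[OF chain_point_in t_in le_t[OF chain_point_in]] rho_t by simp
  then show ?thesis using rho_t by (simp add: flag_exp_chain_point chain_point_def)
qed

lemma multichain_rank_0: "n = 0 \<Longrightarrow> ts = []"
proof (rule ccontr)
  assume "n = 0" "ts \<noteq> []"
  then have "last ts \<in> P" "last ts \<noteq> t" using ts by (auto simp: multichains_def)
  then show False using rho_strict[OF _ t_in le_t] rho_t \<open>n = 0\<close> by fastforce
qed

end

end

section \<open>Labels of saturated chains under a C-labeling\<close>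

locale C_labeled = ranked P le rho n z t
  for P :: "'a set" and le rho n z t +
  fixes Lam :: "'a list \<Rightarrow> 'l::linorder list"
  assumes C_labeling: "C_labeling P le n z t Lam"
begin

text \<open>A saturated chain receives the labels of some maximal chain extending it; by the
  C-property all extensions agree.\<close>

definition lab :: "'a list \<Rightarrow> 'l list" where
  "lab ws = take (length ws - 1) (Lam (SOME c. c \<in> chains \<and> take (length ws) c = ws))"

lemma length_Lam: "c \<in> chains \<Longrightarrow> length (Lam c) = n"
  using C_labeling by (simp add: C_labeling_def labeling_def)

lemma lab_eq:
  assumes "c \<in> chains" "take (length ws) c = ws"
  shows "lab ws = take (length ws - 1) (Lam c)"
proof -
  define c' where "c' = (SOME c. c \<in> chains \<and> take (length ws) c = ws)"
  have c': "c' \<in> chains" "take (length ws) c' = ws"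
    unfolding c'_def using someI[of "\<lambda>c. c \<in> chains \<and> take (length ws) c = ws" c] assms by auto
  have "take (length ws - 1) (Lam c') = take (length ws - 1) (Lam c)"
  proof (rule nth_equalityI)
    fix i assume "i < length (take (length ws - 1) (Lam c'))"
    then have i: "i < length ws - 1" "i < n" using length_Lam c' by auto
    \<comment> \<open>The label with list index \<open>i\<close> belongs to the step from element
      \<open>i\<close> to element \<open>i + 1\<close>, so it depends on the first
      \<open>i + 2\<close> elements.\<close>
    then have "min (i + 2) (length ws) = i + 2" by simp
    then have "take (i + 2) ws = take (i + 2) c'" "take (i + 2) ws = take (i + 2) c"
      using arg_cong[OF c'(2), of "take (i + 2)"] arg_cong[OF assms(2), of "take (i + 2)"]
      by simp_all
    then have "take (Suc i + 1) c' = take (Suc i + 1) c" by simp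
    then have "Lam c' ! i = Lam c ! i"
      using C_labeling c'(1) assms(1) i(2) unfolding C_labeling_def
      by (metis One_nat_def Suc_leI atLeastAtMost_iff diff_Suc_1 le_add1 plus_1_eq_Suc)
    then show "take (length ws - 1) (Lam c') ! i = take (length ws - 1) (Lam c) ! i"
      using i by simp
  qed (use length_Lam assms(1) c'(1) in simp)
  then show ?thesis by (simp add: lab_def c'_def)
qed

lemma lab_chain: "c \<in> chains \<Longrightarrow> lab c = Lam c"
  using lab_eq[of c c] length_Lam length_chain by simp

lemma length_lab: "sat_chain ws \<Longrightarrow> length (lab ws) = length ws - 1"
proof -
  assume ws: "sat_chain ws"
  obtain c where "c \<in> chains" "take (length ws) c = ws" using extend_to_chain[OF ws] .
  then show ?thesis using lab_eq length_Lam length_sat_chain_le[OF ws] by simp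
qed

lemma lab_take:
  assumes "sat_chain ws" "0 < k" "k \<le> length ws"
  shows "lab (take k ws) = take (k - 1) (lab ws)"
proof -
  obtain c where c: "c \<in> chains" "take (length ws) c = ws" using extend_to_chain[OF assms(1)] .
  have "take (length (take k ws)) c = take k ws"
    using arg_cong[OF c(2), of "take k"] assms(3) by (simp add: min_def)
  from lab_eq[OF c(1) this] show ?thesis
    using lab_eq[OF c] assms by (simp add: min_def)
qed

text \<open>Since \<open>ws @ vs\<close> extends to some maximal chain, and all extensions carry the
  same labels on it, the quantifier over maximal chains in the definition amounts to one condition
  on \<open>lab\<close>.\<close>

lemma R_labeling_gen_unique:
  fixes incr :: "'l list \<Rightarrow> bool"
  assumes "R_labeling_gen incr P le n z t Lam"
    and ws: "sat_chain ws" and u: "u \<in> P" "le (last ws) u" "last ws \<noteq> u"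
  shows "\<exists>!vs. vs \<noteq> [] \<and> sat_chain (ws @ vs) \<and> last (ws @ vs) = u \<and>
    incr (drop (length ws - 1) (lab (ws @ vs)))"
proof -
  have eq: "(\<forall>c\<in>chains. take (length ws + length vs) c = ws @ vs \<longrightarrow>
      incr (take (length vs) (drop (length ws - 1) (Lam c)))) \<longleftrightarrow>
      incr (drop (length ws - 1) (lab (ws @ vs)))" if wsvs: "sat_chain (ws @ vs)" for vs
  proof -
    have "take (length vs) (drop (length ws - 1) (Lam c)) = drop (length ws - 1) (lab (ws @ vs))"
      if "c \<in> chains" "take (length ws + length vs) c = ws @ vs" for c
      using lab_eq[of c "ws @ vs"] that sat_chain_nonempty[OF ws]
      by (cases ws) (simp_all add: take_drop add.commute)
    moreover obtain c where "c \<in> chains" "take (length (ws @ vs)) c = ws @ vs"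
      using extend_to_chain[OF wsvs] .
    ultimately show ?thesis by (metis length_append)
  qed
  have "\<exists>!vs. completion P le ws u vs \<and>
      (\<forall>c\<in>chains. take (length ws + length vs) c = ws @ vs \<longrightarrow>
        incr (take (length vs) (drop (length ws - 1) (Lam c))))"
    using assms by (simp add: R_labeling_gen_def)
  then show ?thesis
    unfolding sat_chain_append_iff_completion[OF ws]
    using eq by (elim ex1E) (intro ex1I, blast+)
qed

end

subsection \<open>Flag coefficients as block-increasing label words\<close>

text \<open>Keeping \<open>R\<close> abstract lets the weak and strict cases share one proof; for
  \<open>\<le>\<close> and \<open><\<close> this is the lexicographic order on pairs and its strict
  part.\<close>

definition lex_rel :: "('l \<Rightarrow> 'l \<Rightarrow> bool) \<Rightarrow> nat \<times> 'l \<Rightarrow> nat \<times> 'l \<Rightarrow> bool" where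
  "lex_rel R x y \<longleftrightarrow> fst x < fst y \<or> fst x = fst y \<and> R (snd x) (snd y)"

lemma lex_rel_le: "lex_rel (\<le>) = ((\<le>) :: nat \<times> 'l::linorder \<Rightarrow> _)"
  by (auto simp: lex_rel_def less_eq_prod_def fun_eq_iff)

lemma lex_rel_less: "lex_rel (<) = ((<) :: nat \<times> 'l::linorder \<Rightarrow> _)"
  by (auto simp: lex_rel_def less_prod_def fun_eq_iff)

lemma sum_count_nth: "(\<Sum>i<j. count (mset g) i) = card {q. q < length g \<and> g ! q < (j :: nat)}"
proof (induction j)
  case (Suc j)
  have "{q. q < length g \<and> g ! q < Suc j} =
      {q. q < length g \<and> g ! q < j} \<union> {q. q < length g \<and> g ! q = j}" by auto
  then have "card {q. q < length g \<and> g ! q < Suc j} =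
      card {q. q < length g \<and> g ! q < j} + card {q. q < length g \<and> g ! q = j}"
    by (simp only:) (subst card_Un_disjoint, auto)
  then show ?case using Suc count_mset_nth[of g j] by simp
qed simp

text \<open>In a sorted word the letter \<open>j\<close> fills one interval of positions, starting
  at the number of letters below \<open>j\<close>. \<open>sorted_nth_block\<close> is the converse
  reading.\<close>

lemma sorted_block_position:
  assumes "sorted g" "p < length g"
  shows "(\<Sum>i<g ! p. count (mset g) i) \<le> p" "p < (\<Sum>i<Suc (g ! p). count (mset g) i)"
proof -
  have "{q. q < length g \<and> g ! q < g ! p} \<subseteq> {..<p}"
    using assms sorted_nth_mono[of g p] by (auto simp: not_le[symmetric])
  from card_mono[OF _ this] show "(\<Sum>i<g ! p. count (mset g) i) \<le> p"
    by (simp add: sum_count_nth)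
  have "{..p} \<subseteq> {q. q < length g \<and> g ! q < Suc (g ! p)}"
    using assms sorted_nth_mono[of g _ p] by (auto simp: less_Suc_eq_le)
  from card_mono[OF _ this] show "p < (\<Sum>i<Suc (g ! p). count (mset g) i)"
    unfolding sum_count_nth by simp
qed

lemma sorted_nth_block:
  assumes "sorted g" "(\<Sum>i<j. count (mset g) i) \<le> p" "p < (\<Sum>i<Suc j. count (mset g) i)"
  shows "p < length g" "g ! p = j"
proof -
  let ?s = "\<lambda>j. \<Sum>i<j. count (mset g) i"
  have "?s (Suc j) \<le> card {..<length g}"
    unfolding sum_count_nth by (rule card_mono) auto
  then show p: "p < length g" using assms(3) by simp
  have mono: "?s a \<le> ?s b" if "a \<le> b" for a b
    using that by (intro sum_mono2) auto
  have "\<not> g ! p < j"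
    using mono[of "Suc (g ! p)" j] sorted_block_position(2)[OF assms(1) p] assms(2) by linarith
  moreover have "\<not> j < g ! p"
    using mono[of "Suc j" "g ! p"] sorted_block_position(1)[OF assms(1) p] assms(3) by linarith
  ultimately show "g ! p = j" by simp
qed

text \<open>Pairs in different blocks are already ordered by their first entries, so only pairs
  within one block impose a condition on \<open>w\<close>.\<close>

lemma sorted_wrt_lex_rel_zip:
  assumes g: "sorted g" and len: "length g = length w"
  shows "sorted_wrt (lex_rel R) (zip g w) \<longleftrightarrow>
    (\<forall>j. sorted_wrt R (take (count (mset g) j) (drop (\<Sum>i<j. count (mset g) i) w)))"
    (is "?L \<longleftrightarrow> ?R")
proof -
  let ?s = "\<lambda>j. \<Sum>i<j. count (mset g) i"
  have "?L \<longleftrightarrow> (\<forall>p q. p < q \<longrightarrow> q < length g \<longrightarrow> g ! p = g ! q \<longrightarrow> R (w ! p) (w ! q))"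
  proof -
    have "g ! p < g ! q \<or> g ! p = g ! q" if "p < q" "q < length g" for p q
      using sorted_nth_mono[OF g, of p q] that by auto
    then show ?thesis using len by (fastforce simp: sorted_wrt_iff_nth_less lex_rel_def)
  qed
  also have "\<dots> \<longleftrightarrow> ?R"
  proof (intro iffI allI impI)
    fix j
    assume L: "\<forall>p q. p < q \<longrightarrow> q < length g \<longrightarrow> g ! p = g ! q \<longrightarrow> R (w ! p) (w ! q)"
    show "sorted_wrt R (take (count (mset g) j) (drop (?s j) w))"
      unfolding sorted_wrt_iff_nth_less
    proof (intro allI impI)
      fix p q assume pq: "p < q" "q < length (take (count (mset g) j) (drop (?s j) w))"
      then have "g ! (?s j + p) = j" "g ! (?s j + q) = j" "?s j + q < length g"
        using sorted_nth_block[OF g, of j "?s j + p"] sorted_nth_block[OF g, of j "?s j + q"] by auto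
      then have "R (w ! (?s j + p)) (w ! (?s j + q))" using L pq by simp
      then show "R (take (count (mset g) j) (drop (?s j) w) ! p) (take (count (mset g) j) (drop (?s j) w) ! q)"
        using pq \<open>?s j + q < length g\<close> len by simp
    qed
  next
    fix p q
    assume R: "?R" and pq: "p < q" "q < length g" "g ! p = g ! q"
    let ?j = "g ! q"
    have b: "?s ?j \<le> p" "q < ?s ?j + count (mset g) ?j"
      using sorted_block_position[OF g, of p] sorted_block_position[OF g, of q] pq by simp_all
    have "q - ?s ?j < length (take (count (mset g) ?j) (drop (?s ?j) w))"
      using b pq len by simp linarith
    moreover have "p - ?s ?j < q - ?s ?j" using b pq by simp
    ultimately have "R (take (count (mset g) ?j) (drop (?s ?j) w) ! (p - ?s ?j))
        (take (count (mset g) ?j) (drop (?s ?j) w) ! (q - ?s ?j))"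
      using R by (simp add: sorted_wrt_iff_nth_less)
    then show "R (w ! p) (w ! q)" using b pq len by simp
  qed
  finally show ?thesis .
qed

lemma deg_count: "deg (count M) = size M"
proof -
  have "{i. count M i \<noteq> 0} = set_mset M" by (auto simp: count_eq_zero_iff)
  then show ?thesis by (simp add: size_multiset_overloaded_eq deg_def)
qed

lemma sorted_word_of_content:
  fixes \<alpha> :: "nat \<Rightarrow> nat"
  assumes "fin_supp \<alpha>"
  obtains g where "sorted g" "count (mset g) = \<alpha>" "length g = deg \<alpha>"
proof -
  define M where "M = Abs_multiset \<alpha>"
  have M: "count M = \<alpha>" unfolding M_def
    by (rule count_Abs_multiset) (use assms in \<open>simp add: fin_supp_def\<close>)
  have "length (sorted_list_of_multiset M) = deg \<alpha>"
    by (metis M deg_count mset_sorted_list_of_multiset size_mset)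
  then show ?thesis
    using that[of "sorted_list_of_multiset M"] M by simp
qed

text \<open>The first components are sorted with content \<alpha>, hence form one fixed word
  \<open>g\<close>; only the second components vary.\<close>

lemma card_lex_sorted_words:
  fixes A :: "'l list set"
  assumes "fin_supp \<alpha>" and len: "\<And>w. w \<in> A \<Longrightarrow> length w = deg \<alpha>"
  shows "card {x :: (nat \<times> 'l) list. map snd x \<in> A \<and> count (mset (map fst x)) = \<alpha> \<and> sorted_wrt (lex_rel R) x} =
    card {w \<in> A. \<forall>j. sorted_wrt R (take (\<alpha> j) (drop (\<Sum>i<j. \<alpha> i) w))}"
proof -
  obtain g where g: "sorted g" "count (mset g) = \<alpha>" "length g = deg \<alpha>"
    using sorted_word_of_content[OF assms(1)] .
  have fst_eq: "map fst x = g" if "count (mset (map fst x)) = \<alpha>" "sorted_wrt (lex_rel R) x" for x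
  proof -
    have "sorted (map fst x)"
      unfolding sorted_map by (rule sorted_wrt_mono_rel[OF _ that(2)]) (auto simp: lex_rel_def)
    moreover have "mset (map fst x) = mset g"
      using that(1) g(2) by (simp only: multiset_eq_iff) simp
    ultimately show ?thesis using g(1) by (metis properties_for_sort sorted_sort_id)
  qed
  have "bij_betw (map snd)
    {x :: (nat \<times> 'l) list. map snd x \<in> A \<and> count (mset (map fst x)) = \<alpha> \<and> sorted_wrt (lex_rel R) x}
    {w \<in> A. \<forall>j. sorted_wrt R (take (\<alpha> j) (drop (\<Sum>i<j. \<alpha> i) w))}"
  proof (rule bij_betw_byWitness[where f' = "zip g"])
    show "\<forall>x\<in>{x. map snd x \<in> A \<and> count (mset (map fst x)) = \<alpha> \<and> sorted_wrt (lex_rel R) x}.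
        zip g (map snd x) = x"
    proof
      fix x assume "x \<in> {x. map snd x \<in> A \<and> count (mset (map fst x)) = \<alpha> \<and> sorted_wrt (lex_rel R) x}"
      then have "map fst x = g" using fst_eq by blast
      then show "zip g (map snd x) = x" using zip_map_fst_snd by metis
    qed
    show "\<forall>w\<in>{w \<in> A. \<forall>j. sorted_wrt R (take (\<alpha> j) (drop (\<Sum>i<j. \<alpha> i) w))}. map snd (zip g w) = w"
      using g len by simp
    show "map snd ` {x. map snd x \<in> A \<and> count (mset (map fst x)) = \<alpha> \<and> sorted_wrt (lex_rel R) x} \<subseteq>
      {w \<in> A. \<forall>j. sorted_wrt R (take (\<alpha> j) (drop (\<Sum>i<j. \<alpha> i) w))}"
    proof (rule image_subsetI)
      fix x assume x: "x \<in> {x. map snd x \<in> A \<and> count (mset (map fst x)) = \<alpha> \<and> sorted_wrt (lex_rel R) x}"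
      then have "map fst x = g" using fst_eq by blast
      then have "x = zip g (map snd x)" using zip_map_fst_snd by metis
      then show "map snd x \<in> {w \<in> A. \<forall>j. sorted_wrt R (take (\<alpha> j) (drop (\<Sum>i<j. \<alpha> i) w))}"
        using x sorted_wrt_lex_rel_zip[OF g(1), of "map snd x" R] g(2,3) len[of "map snd x"] by simp
    qed
    show "zip g ` {w \<in> A. \<forall>j. sorted_wrt R (take (\<alpha> j) (drop (\<Sum>i<j. \<alpha> i) w))} \<subseteq>
      {x. map snd x \<in> A \<and> count (mset (map fst x)) = \<alpha> \<and> sorted_wrt (lex_rel R) x}"
    proof (rule image_subsetI)
      fix w assume w: "w \<in> {w \<in> A. \<forall>j. sorted_wrt R (take (\<alpha> j) (drop (\<Sum>i<j. \<alpha> i) w))}"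
      then have "length g = length w" using len g(3) by simp
      then show "zip g w \<in> {x. map snd x \<in> A \<and> count (mset (map fst x)) = \<alpha> \<and> sorted_wrt (lex_rel R) x}"
        using w sorted_wrt_lex_rel_zip[OF g(1), of w R] g(2) by (simp del: mset_map)
    qed
  qed
  then show ?thesis by (rule bij_betw_same_card)
qed

context C_labeled
begin

text \<open>Here \<open>e\<close> lists the points to be met, weakly increasing and possibly with
  repetitions. The induction on \<open>j\<close> works because the R-condition holds above every
  initial chain: the last piece is the unique increasing completion of the chain already built up to
  \<open>e j\<close>.\<close>

lemma block_chain_unique:
  fixes e :: "nat \<Rightarrow> 'a" and \<alpha> :: "nat \<Rightarrow> nat"
  assumes R: "R_labeling_gen (sorted_wrt R) P le n z t Lam"
    and e: "e 0 = z" "\<And>i. e i \<in> P" "\<And>i. le (e i) (e (Suc i))" "\<And>i. rho (e i) = (\<Sum>k<i. \<alpha> k)"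
  shows "\<exists>!ws. sat_chain ws \<and> last ws = e j \<and> (\<forall>i\<le>j. ws ! (\<Sum>k<i. \<alpha> k) = e i) \<and>
    (\<forall>i<j. sorted_wrt R (take (\<alpha> i) (drop (\<Sum>k<i. \<alpha> k) (lab ws))))"
proof (induction j)
  case 0
  have unique: "ws = [z]" if "sat_chain ws" "last ws = e 0" for ws
    using length_sat_chain[OF that(1)] sat_chain_nth_0[OF that(1)] that(2) e(1) rho_z
    by (cases ws) auto
  show ?case
  proof (rule ex1I[of _ "[z]"])
    show "sat_chain [z] \<and> last [z] = e 0 \<and> (\<forall>i\<le>0. [z] ! (\<Sum>k<i. \<alpha> k) = e i) \<and>
        (\<forall>i<0. sorted_wrt R (take (\<alpha> i) (drop (\<Sum>k<i. \<alpha> k) (lab [z]))))"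
      using e(1) sat_chain_z by simp
  qed (use unique in blast)
next
  case (Suc j)
  let ?s = "\<lambda>j. \<Sum>k<j. \<alpha> k"
  let ?Q = "\<lambda>j ws. sat_chain ws \<and> last ws = e j \<and> (\<forall>i\<le>j. ws ! ?s i = e i) \<and>
    (\<forall>i<j. sorted_wrt R (take (\<alpha> i) (drop (?s i) (lab ws))))"
  have mono: "?s a \<le> ?s b" if "a \<le> b" for a b
    using that by (intro sum_mono2) auto
  have len: "length ws = Suc (?s i)" if "sat_chain ws" "last ws = e i" for ws i
    using length_sat_chain[OF that(1)] that(2) e(4) by simp
  show ?case
  proof (cases "e j = e (Suc j)")
    case True
    \<comment> \<open>A repeated point contributes an empty block and no new elements; the
      R-condition speaks of distinct endpoints.\<close>
    then have "\<alpha> j = 0" using e(4)[of j] e(4)[of "Suc j"] by simp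
    then have "?Q (Suc j) ws \<longleftrightarrow> ?Q j ws" for ws
      using True by (auto simp: le_Suc_eq less_Suc_eq)
    then show ?thesis using Suc by simp
  next
    case False
    obtain w where w: "?Q j w" and w_unique: "\<forall>w'. ?Q j w' \<longrightarrow> w' = w"
      using Suc by (elim ex1E) (rule that)
    have lw: "length w = Suc (?s j)" using len w by blast
    \<comment> \<open>Blocks below \<open>e j\<close> lie entirely within the labels of the
      truncated chain.\<close>
    have blocks: "take (\<alpha> i) (drop (?s i) (lab (take (Suc (?s j)) ws))) = take (\<alpha> i) (drop (?s i) (lab ws))"
      if "sat_chain ws" "Suc (?s j) \<le> length ws" "i < j" for ws i
    proof -
      have "?s (Suc i) \<le> ?s j" using mono[of "Suc i" j] that(3) by simp
      then have "min (\<alpha> i) (?s j - ?s i) = \<alpha> i" by simp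
      then show ?thesis
        using lab_take[OF that(1) _ that(2)] by (simp add: drop_take)
    qed
    \<comment> \<open>A chain ending at \<open>e (Suc j)\<close> has exactly
      \<open>\<alpha> j\<close> labels after the first \<open>?s j\<close>, so the last block is the
      whole remainder.\<close>
    have final: "take (\<alpha> j) (drop (?s j) (lab ws)) = drop (?s j) (lab ws)"
      if "sat_chain ws" "last ws = e (Suc j)" for ws
      using length_lab[OF that(1)] len[OF that] by simp
    have "last w = e j" "sat_chain w" using w by auto
    then have ex: "\<exists>!vs. vs \<noteq> [] \<and> sat_chain (w @ vs) \<and> last (w @ vs) = e (Suc j) \<and>
        sorted_wrt R (drop (?s j) (lab (w @ vs)))"
      using R_labeling_gen_unique[OF R \<open>sat_chain w\<close> e(2)[of "Suc j"]] e(3)[of j] False lw by simp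
    obtain vs where V: "vs \<noteq> [] \<and> sat_chain (w @ vs) \<and> last (w @ vs) = e (Suc j) \<and>
        sorted_wrt R (drop (?s j) (lab (w @ vs)))"
      and vs_unique: "\<forall>vs'. vs' \<noteq> [] \<and> sat_chain (w @ vs') \<and> last (w @ vs') = e (Suc j) \<and>
        sorted_wrt R (drop (?s j) (lab (w @ vs'))) \<longrightarrow> vs' = vs"
      using ex by (elim ex1E) (rule that)
    from V have vs: "vs \<noteq> []" "sat_chain (w @ vs)" "last (w @ vs) = e (Suc j)"
      "sorted_wrt R (drop (?s j) (lab (w @ vs)))" by blast+
    show ?thesis
    proof (rule ex1I[of _ "w @ vs"])
      have "(w @ vs) ! ?s i = e i" if "i \<le> Suc j" for i
      proof (cases "i = Suc j")
        case True
        have "?s (Suc j) = length (w @ vs) - 1" using len[OF vs(2,3)] by simp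
        then show ?thesis using True vs(1,3) by (simp only:) (metis append_is_Nil_conv last_conv_nth)
      next
        case False
        then have "?s i < length w" using mono[of i j] that lw by simp
        then show ?thesis using w that False by (simp add: nth_append)
      qed
      moreover have "sorted_wrt R (take (\<alpha> i) (drop (?s i) (lab (w @ vs))))" if "i < Suc j" for i
      proof (cases "i = j")
        case True
        then show ?thesis using final[OF vs(2,3)] vs(4) by simp
      next
        case False
        then have "i < j" using that by simp
        then show ?thesis using blocks[OF vs(2), of i, symmetric] w lw by simp
      qed
      ultimately show "?Q (Suc j) (w @ vs)" using vs by blast
    next
      fix ws assume ws: "?Q (Suc j) ws"
      then have sc: "sat_chain ws" and lst: "last ws = e (Suc j)" by auto
      have lws: "length ws = Suc (?s (Suc j))" by (rule len[OF sc lst])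
      \<comment> \<open>A competitor is cut at height \<open>?s j\<close>: its lower part satisfies
        the condition for \<open>j\<close>, hence is \<open>w\<close>, and its upper part is a
        completion of \<open>w\<close>.\<close>
      let ?w = "take (Suc (?s j)) ws"
      have scw: "sat_chain ?w" using sat_chain_take[OF sc] by simp
      have "last ?w = ws ! ?s j"         using lws by (simp add: last_conv_nth[OF sat_chain_nonempty[OF scw]])
      then have "last ?w = e j" using ws by simp
      moreover have "?w ! ?s i = e i" if "i \<le> j" for i
        using mono[OF that] ws that by (simp add: less_Suc_eq_le)
      moreover have "sorted_wrt R (take (\<alpha> i) (drop (?s i) (lab ?w)))" if "i < j" for i
        using blocks[OF sc _ that] lws ws that by simp
      ultimately have "?Q j ?w" using scw by blast
      then have "?w = w" using w_unique by simp
      then have split: "ws = w @ drop (Suc (?s j)) ws" by (metis append_take_drop_id)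
      have "drop (Suc (?s j)) ws \<noteq> []"
      proof
        assume "drop (Suc (?s j)) ws = []"
        then have "ws = w" using split by simp
        then show False using \<open>last w = e j\<close> lst False by simp
      qed
      moreover have "sorted_wrt R (drop (?s j) (lab ws))"
        using ws final[OF sc lst] by (metis lessI)
      ultimately have "drop (Suc (?s j)) ws = vs"
        using vs_unique[rule_format, of "drop (Suc (?s j)) ws"] split sc lst by metis
      then show "ws = w @ vs" using split by simp
    qed
  qed
qed

text \<open>The inverse of refining a multichain is sampling: a maximal chain gives back its
  elements at the ranks that are partial sums of \<alpha>.\<close>

lemma flag_F_chains:
  assumes R: "R_labeling_gen (sorted_wrt R) P le n z t Lam" and \<alpha>: "fin_supp \<alpha>" "deg \<alpha> = n"
  shows "flag_F P le rho z t \<alpha> =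
    real (card {c \<in> chains. \<forall>j. sorted_wrt R (take (\<alpha> j) (drop (\<Sum>i<j. \<alpha> i) (Lam c)))})"
proof -
  let ?s = "\<lambda>j. \<Sum>k<j. \<alpha> k"
  let ?X = "{c \<in> chains. \<forall>j. sorted_wrt R (take (\<alpha> j) (drop (?s j) (Lam c)))}"
  let ?T = "{ts \<in> multichains P le t. flag_exp rho z t ts = \<alpha>}"
  \<comment> \<open>The last index with a nonzero exponent, which must be the length of the
    multichain; for \<open>n = 0\<close> there is none, and the only multichain is empty.\<close>
  define K where "K = (if n = 0 then 0 else Max {i. \<alpha> i \<noteq> 0})"
  have fin: "finite {i. \<alpha> i \<noteq> 0}" using \<alpha>(1) by (simp add: fin_supp_def)
  have ne: "{i. \<alpha> i \<noteq> 0} \<noteq> {}" if "n > 0"     using \<alpha>(2) that unfolding deg_def by (metis less_irrefl_nat sum.empty)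
  have zero: "\<alpha> i = 0" if "K < i" for i
  proof (cases "n = 0")
    case True
    then show ?thesis using \<alpha>(2) fin by (auto simp: deg_def)
  next
    case False
    then show ?thesis using Max_ge[OF fin, of i] that by (auto simp: K_def)
  qed
  have pos: "\<alpha> K > 0" if "n > 0"
    using Max_in[OF fin ne[OF that]] that by (simp add: K_def)
  have sn: "?s i = n" if "K < i" for i
  proof -
    have "deg \<alpha> = ?s i"
      unfolding deg_def by (rule sum.mono_neutral_left) (use zero that in \<open>auto simp: not_less[symmetric] intro: ccontr\<close>)
    then show ?thesis using \<alpha>(2) by simp
  qed
  have mono: "?s a \<le> ?s b" if "a \<le> b" for a b
    using that by (intro sum_mono2) auto
  have s_le: "?s i \<le> n" for i
    using mono[of i "max i (Suc K)"] sn[of "max i (Suc K)"] by simp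
  \<comment> \<open>The sample skips index 0, which is \<open>z\<close>, and stops at
    \<open>K\<close>, because index \<open>Suc K\<close> is already \<open>t\<close>.\<close>
  let ?\<Phi> = "\<lambda>c. map (\<lambda>j. c ! ?s j) [1..<Suc K]"
  have into: "?\<Phi> c \<in> ?T" if c: "c \<in> ?X" for c
  proof -
    have sc: "sat_chain c" "last c = t" "length c = n + 1"
      using c length_chain by (auto simp: chains_iff)
    have pt: "c ! ?s j \<in> P" "rho (c ! ?s j) = ?s j" for j
      using sat_chain_nth[OF sc(1), of "?s j"] s_le[of j] sc(3) by auto
    have "successively le (?\<Phi> c)"
      unfolding successively_conv_nth
    proof (intro allI impI)
      fix i assume i: "Suc i < length (?\<Phi> c)"
      have "le (c ! ?s (Suc i)) (c ! ?s (Suc (Suc i)))"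
        using s_le[of "Suc (Suc i)"] sc(3) by (intro sat_chain_le[OF sc(1)]) simp_all
      then show "le (?\<Phi> c ! i) (?\<Phi> c ! Suc i)"
        using i by (simp del: upt_Suc sum.lessThan_Suc)
    qed
    moreover have "last (?\<Phi> c) \<noteq> t" if ne: "?\<Phi> c \<noteq> []"
    proof -
      have K: "K > 0" using ne by (cases K) auto
      then have "n > 0" by (auto simp: K_def split: if_splits)
      have "last (?\<Phi> c) = c ! ?s K" using K by (simp add: last_map)
      moreover have "?s K < n" using pos[OF \<open>n > 0\<close>] sn[of "Suc K"] by simp
      ultimately show ?thesis using pt(2)[of K] rho_t by auto
    qed
    moreover have "set (?\<Phi> c) \<subseteq> P" using pt by auto
    moreover have "flag_exp rho z t (?\<Phi> c) = \<alpha>"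
    proof
      fix i
      have ext: "(z # ?\<Phi> c @ [t]) ! i = c ! ?s i" if "i \<le> Suc K" for i
      proof (cases "i = Suc K")
        case True
        then show ?thesis
          using sn[of "Suc K"] sc by (simp add: nth_append last_conv_nth sat_chain_nonempty)
      next
        case False
        then show ?thesis using that sat_chain_nth_0[OF sc(1)]
          by (cases i) (simp_all add: nth_append del: upt_Suc)
      qed
      show "flag_exp rho z t (?\<Phi> c) i = \<alpha> i"
      proof (cases "i \<le> K")
        case True
        then show ?thesis using ext[of i] ext[of "Suc i"] pt(2)[of i] pt(2)[of "Suc i"]
          by (simp add: flag_exp_def Let_def)
      next
        case False
        then show ?thesis using zero by (simp add: flag_exp_def)
      qed
    qed
    ultimately show ?thesis by (simp add: multichains_def)
  qed
  have ex1: "\<exists>!c. c \<in> ?X \<and> ?\<Phi> c = ts" if ts: "ts \<in> ?T" for ts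
  proof -
    let ?e = "chain_point ts"
    from ts have tsm: "ts \<in> multichains P le t" and exp: "flag_exp rho z t ts = \<alpha>" by auto
    have len: "length ts = K"
    proof (cases "n = 0")
      case True
      then show ?thesis using multichain_rank_0[OF tsm] by (simp add: K_def)
    next
      case False
      then have "\<alpha> (length ts) > 0" using flag_exp_last_pos[OF tsm] exp by simp
      moreover have "\<alpha> i = 0" if "length ts < i" for i
        using that by (simp add: exp[symmetric] flag_exp_def)
      ultimately show ?thesis using zero pos False
        by (metis gr0I less_irrefl_nat linorder_neqE_nat)
    qed
    have "\<exists>!ws. sat_chain ws \<and> last ws = ?e (Suc K) \<and> (\<forall>i\<le>Suc K. ws ! ?s i = ?e i) \<and>
        (\<forall>i<Suc K. sorted_wrt R (take (\<alpha> i) (drop (?s i) (lab ws))))"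
    proof (rule block_chain_unique[OF R])
      show "?e 0 = z" by (simp add: chain_point_def)
      show "?e i \<in> P" "le (?e i) (?e (Suc i))" for i
        by (rule chain_point_in[OF tsm], rule chain_point_le[OF tsm])
      show "rho (?e i) = ?s i" for i using sum_flag_exp[OF tsm, of i] exp by simp
    qed
    moreover have "(sat_chain ws \<and> last ws = ?e (Suc K) \<and> (\<forall>i\<le>Suc K. ws ! ?s i = ?e i) \<and>
        (\<forall>i<Suc K. sorted_wrt R (take (\<alpha> i) (drop (?s i) (lab ws))))) \<longleftrightarrow> (ws \<in> ?X \<and> ?\<Phi> ws = ts)" for ws
    proof -
      have A: "?e (Suc K) = t" using len by (simp add: chain_point_def)
      have B: "(\<forall>i\<le>Suc K. ws ! ?s i = ?e i) \<longleftrightarrow> ?\<Phi> ws = ts" if ws: "ws \<in> chains"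
      proof -
        have sc: "sat_chain ws" "last ws = t" "length ws = n + 1"
          using ws length_chain by (auto simp: chains_iff)
        have ends: "ws ! ?s 0 = ?e 0" "ws ! ?s (Suc K) = ?e (Suc K)"
          using sat_chain_nth_0[OF sc(1)] sn[of "Suc K"] sc len
          by (simp_all add: chain_point_def last_conv_nth sat_chain_nonempty)
        \<comment> \<open>Agreement at both ends is automatic, which leaves the \<open>K\<close>
          sampled elements.\<close>
        have "(\<forall>i\<le>Suc K. ws ! ?s i = ?e i) \<longleftrightarrow> (\<forall>i<K. ws ! ?s (Suc i) = ?e (Suc i))"
        proof (intro iffI allI impI)
          fix i assume "\<forall>i<K. ws ! ?s (Suc i) = ?e (Suc i)" "i \<le> Suc K"
          then show "ws ! ?s i = ?e i"
            using ends by (cases i, simp, cases "i = Suc K") (simp_all del: sum.lessThan_Suc)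
        qed (simp del: sum.lessThan_Suc)
        moreover have "?\<Phi> ws = ts \<longleftrightarrow> (\<forall>i<K. ws ! ?s (Suc i) = ?e (Suc i))"
          using len by (auto simp: list_eq_iff_nth_eq[of _ ts] chain_point_def simp del: upt_Suc)
        ultimately show ?thesis by (simp only:)
      qed
      \<comment> \<open>Blocks beyond \<open>K\<close> are empty, hence increasing.\<close>
      have C: "(\<forall>i<Suc K. sorted_wrt R (take (\<alpha> i) (drop (?s i) (lab ws)))) \<longleftrightarrow>
          (\<forall>i. sorted_wrt R (take (\<alpha> i) (drop (?s i) (Lam ws))))" if ws: "ws \<in> chains"
        using zero lab_chain[OF ws] by (metis not_less_eq sorted_wrt.simps(1) take_0)
      show ?thesis
      proof (cases "ws \<in> chains")
        case True
        then have "sat_chain ws" "last ws = t" by (simp_all add: chains_iff)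
        then show ?thesis using B[OF True] C[OF True] True A by (simp only: mem_Collect_eq simp_thms conj_commute)
      next
        case False
        then show ?thesis using A by (auto simp: chains_iff)
      qed
    qed
    ultimately show ?thesis by simp
  qed
  have "bij_betw ?\<Phi> ?X ?T"
  proof (rule bij_betwI')
    fix c c' assume c: "c \<in> ?X" and c': "c' \<in> ?X"
    obtain d where d: "\<forall>y. y \<in> ?X \<and> ?\<Phi> y = ?\<Phi> c \<longrightarrow> y = d"
      using ex1[OF into[OF c]] by (elim ex1E) (rule that)
    show "?\<Phi> c = ?\<Phi> c' \<longleftrightarrow> c = c'"
    proof
      assume eq: "?\<Phi> c = ?\<Phi> c'"
      have "c = d" by (rule d[rule_format]) (use c in simp)
      moreover have "c' = d" by (rule d[rule_format]) (rule conjI[OF c' eq[symmetric]])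
      ultimately show "c = c'" by simp
    qed simp
  next
    fix c assume "c \<in> ?X" then show "?\<Phi> c \<in> ?T" by (rule into)
  next
    fix ts assume ts: "ts \<in> ?T"
    obtain c where c: "c \<in> ?X \<and> ?\<Phi> c = ts"
      using ex1[OF ts, THEN ex1_implies_ex] by (elim exE) (rule that)
    show "\<exists>c\<in>?X. ts = ?\<Phi> c"
      by (rule bexI[of _ c], rule conjunct2[OF c, symmetric], rule conjunct1[OF c])
  qed
  from bij_betw_same_card[OF this] show ?thesis by (simp add: flag_F_def)
qed

lemma flag_F_words:
  assumes R: "R_labeling_gen (sorted_wrt R) P le n z t Lam" and inj: "inj_on Lam chains"
  shows "flag_F P le rho z t \<alpha> = real (card {x :: (nat \<times> 'l) list.
    map snd x \<in> Lam ` chains \<and> count (mset (map fst x)) = \<alpha> \<and> sorted_wrt (lex_rel R) x})"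
proof (cases "fin_supp \<alpha> \<and> deg \<alpha> = n")
  case True
  let ?B = "\<lambda>w. \<forall>j. sorted_wrt R (take (\<alpha> j) (drop (\<Sum>i<j. \<alpha> i) w))"
  have "card {c \<in> chains. ?B (Lam c)} = card (Lam ` {c \<in> chains. ?B (Lam c)})"
    by (rule card_image[symmetric], rule inj_on_subset[OF inj]) auto
  also have "Lam ` {c \<in> chains. ?B (Lam c)} = {w \<in> Lam ` chains. ?B w}" by auto
  finally have "card {c \<in> chains. ?B (Lam c)} = card {w \<in> Lam ` chains. ?B w}" .
  moreover have "length w = deg \<alpha>" if "w \<in> Lam ` chains" for w
    using that True length_Lam by auto
  ultimately show ?thesis
    using True flag_F_chains[OF R, of \<alpha>] card_lex_sorted_words[of \<alpha> "Lam ` chains" R]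
    by presburger
next
  case False
  have empty1: "{ts \<in> multichains P le t. flag_exp rho z t ts = \<alpha>} = {}"
    using False fin_supp_flag_exp deg_flag_exp by auto
  have empty2: "{x :: (nat \<times> 'l) list. map snd x \<in> Lam ` chains \<and> count (mset (map fst x)) = \<alpha> \<and>
      sorted_wrt (lex_rel R) x} = {}"
  proof -
    have "fin_supp \<alpha> \<and> deg \<alpha> = n"
      if x: "map snd x \<in> Lam ` chains" "count (mset (map fst x)) = \<alpha>" for x :: "(nat \<times> 'l) list"
    proof -
      have "length (map snd x) = n" using x(1) by (metis imageE length_Lam)
      then show ?thesis
        using x(2) fin_supp_count[of "mset (map fst x)"] deg_count[of "mset (map fst x)"] by auto
    qed
    then show ?thesis using False by blast
  qed
  show ?thesis unfolding flag_F_def empty1 empty2 by simp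
qed

end

subsection \<open>S-labelings\<close>

text \<open>Bubble the first letter of the target to the front, then rearrange the rest behind it;
  the induction passes from \<open>Q\<close> to \<open>\<lambda>w. Q (a # w)\<close>.\<close>

lemma adjacent_swaps_rearrange:
  assumes swap: "\<And>p x y q. Q (p @ x # y # q) \<Longrightarrow> Q (p @ y # x # q)"
    and "Q u" "mset u = mset v"
  shows "Q v"
  using assms
proof (induction v arbitrary: u Q)
  case Nil
  then show ?case by simp
next
  case (Cons a v)
  then have "a \<in> set u" by (metis list.set_intros(1) set_mset_mset)
  then obtain p q where u: "u = p @ a # q" by (meson split_list)
  have "Q (p' @ a # q') \<Longrightarrow> Q (a # p' @ q')" for p' q'
  proof (induction p' arbitrary: q' rule: rev_induct)
    case (snoc b p')
    then have "Q (p' @ a # b # q')" using Cons.prems(1)[of p' b a q'] by simp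
    then show ?case using snoc.IH[of "b # q'"] by simp
  qed simp
  then have "Q (a # p @ q)" using Cons.prems(2) u by blast
  moreover have "Q (a # p' @ y # x # q')" if "Q (a # p' @ x # y # q')" for p' x y q'
    using Cons.prems(1)[of "a # p'" x y q'] that by simp
  ultimately show ?case
    using Cons.IH[of "\<lambda>w. Q (a # w)" "p @ q"] Cons.prems(3) u by simp
qed

lemma sum_over_types:
  fixes f :: "nat list \<Rightarrow> real" and T :: "'b \<Rightarrow> nat list"
  assumes "finite S" "T ` S \<subseteq> partitions n"
  shows "(\<Sum>m\<in>S. f (T m)) = (\<Sum>\<mu>\<in>partitions n. real (card {m \<in> S. T m = \<mu>}) * f \<mu>)"
proof -
  have "(\<Sum>m\<in>S. f (T m)) = (\<Sum>\<mu>\<in>partitions n. \<Sum>m\<in>{m \<in> S. T m = \<mu>}. f (T m))"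
    by (rule sum.group[symmetric]) (use assms finite_partitions in auto)
  also have "\<dots> = (\<Sum>\<mu>\<in>partitions n. real (card {m \<in> S. T m = \<mu>}) * f \<mu>)"
    by (rule sum.cong) auto
  finally show ?thesis .
qed

text \<open>Since \<open>A\<close> is a union of rearrangement classes, membership of the second row
  in \<open>A\<close> depends only on its content.\<close>

lemma card_words_by_content:
  fixes A :: "'l list set" and W :: "(nat \<times> 'l) list \<Rightarrow> bool"
  assumes "finite A" and closed: "\<And>w v. w \<in> A \<Longrightarrow> mset v = mset w \<Longrightarrow> v \<in> A"
  shows "card {x. map snd x \<in> A \<and> count (mset (map fst x)) = \<alpha> \<and> W x} =
    (\<Sum>m\<in>mset ` A. card {x. mset (map snd x) = m \<and> count (mset (map fst x)) = \<alpha> \<and> W x})"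
proof -
  let ?F = "\<lambda>m. {x. mset (map snd x) = m \<and> count (mset (map fst x)) = \<alpha> \<and> W x}"
  have fin: "finite (?F m)" for m
  proof (cases "\<exists>w. mset w = m")
    case True
    then obtain w0 where w0: "mset w0 = m" by blast
    have "?F m \<subseteq> (\<lambda>(w, g). zip g w) ` ({w. mset w = mset w0} \<times> {g. count (mset g) = \<alpha>})"
    proof
      fix x assume "x \<in> ?F m"
      then show "x \<in> (\<lambda>(w, g). zip g w) ` ({w. mset w = mset w0} \<times> {g. count (mset g) = \<alpha>})"
        using w0 by (intro image_eqI[where x="(map snd x, map fst x)"]) (auto simp: zip_map_fst_snd)
    qed
    moreover have "finite ({w. mset w = mset w0} \<times> {g. count (mset g) = \<alpha>})"
      using mset_eq_finite[of w0] finite_words_of_content[of \<alpha>] by (rule finite_cartesian_product)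
    ultimately show ?thesis using finite_subset by blast
  next
    case False
    then have "?F m = {}" by blast
    then show ?thesis by (simp only: finite.emptyI)
  qed
  have "{x. map snd x \<in> A \<and> count (mset (map fst x)) = \<alpha> \<and> W x} = (\<Union>m\<in>mset ` A. ?F m)"
  proof (intro equalityI subsetI)
    fix x assume "x \<in> (\<Union>m\<in>mset ` A. ?F m)"
    then obtain w where w: "w \<in> A" "mset (map snd x) = mset w" "count (mset (map fst x)) = \<alpha>" "W x"
      by (elim UN_E imageE) simp
    then show "x \<in> {x. map snd x \<in> A \<and> count (mset (map fst x)) = \<alpha> \<and> W x}"
      using closed[OF w(1,2)] by simp
  next
    fix x assume "x \<in> {x. map snd x \<in> A \<and> count (mset (map fst x)) = \<alpha> \<and> W x}"
    then show "x \<in> (\<Union>m\<in>mset ` A. ?F m)" by blast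
  qed
  also have "card \<dots> = (\<Sum>m\<in>mset ` A. card (?F m))"
    by (rule card_UN_disjoint) (use assms(1) fin in auto)
  finally show ?thesis .
qed

locale S_labeled = C_labeled P le rho n z t Lam
  for P :: "'a set" and le rho n z t and Lam :: "'a list \<Rightarrow> 'l::linorder list" +
  assumes S_labeling: "S_labeling P le n z t Lam"
begin

abbreviation words :: "'l list set" where
  "words \<equiv> Lam ` chains"

lemma inj_Lam: "inj_on Lam chains"
  using S_labeling by (simp add: S_labeling_def)

text \<open>The labels at list positions \<open>length p\<close> and \<open>Suc (length p)\<close>
  sit on the two steps meeting at rank \<open>Suc (length p)\<close>, the only place where the chain
  may change. For equal labels the chain itself serves.\<close>

lemma swap_chain:
  assumes c: "c \<in> chains" and Lc: "Lam c = p @ x # y # q"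
  obtains c' where "c' \<in> chains" "Lam c' = p @ y # x # q" "\<And>j. j \<noteq> Suc (length p) \<Longrightarrow> c' ! j = c ! j"
proof (cases "x = y")
  case True
  then show ?thesis using that[of c] assms by simp
next
  case False
  let ?i = "Suc (length p)"
  have "n = length p + 2 + length q" using length_Lam[OF c] Lc by simp
  then have "?i \<in> {1..n-1}" by simp
  moreover have "Lam c ! (?i - 1) = x" "Lam c ! ?i = y"
    using Lc by (simp_all add: nth_append)
  moreover have "(Lam c)[?i - 1 := y, ?i := x] = p @ y # x # q"
    using Lc by (simp add: list_update_append)
  ultimately have "\<exists>!c'. c' \<in> chains \<and> (\<forall>j. j \<noteq> ?i \<longrightarrow> c' ! j = c ! j) \<and> Lam c' = p @ y # x # q"
    using S_labeling c False unfolding S_labeling_def by metis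
  then show ?thesis using that by blast
qed

text \<open>Swaps inside the block \<open>u\<close> move only elements at ranks strictly between its
  two ends. This locality is what later keeps a prescribed element on the chain.\<close>

lemma rearrange_chain:
  assumes c: "c \<in> chains" and Lc: "Lam c = X @ u @ Y" and "mset u = mset v"
  obtains c' where "c' \<in> chains" "Lam c' = X @ v @ Y"
    "\<And>j. j \<le> length X \<or> length X + length u \<le> j \<Longrightarrow> c' ! j = c ! j"
proof -
  \<comment> \<open>The length clause bounds the position of a swap, which keeps both ends of the
    block untouched.\<close>
  let ?Q = "\<lambda>w. length w = length u \<and> (\<exists>c'\<in>chains. Lam c' = X @ w @ Y \<and>
    (\<forall>j. j \<le> length X \<or> length X + length u \<le> j \<longrightarrow> c' ! j = c ! j))"
  have "?Q v"
  proof (rule adjacent_swaps_rearrange[of ?Q u])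
    show "?Q u" using c Lc by blast
    fix p x y q assume Q: "?Q (p @ x # y # q)"
    then obtain c' where c': "c' \<in> chains" "Lam c' = (X @ p) @ x # y # q @ Y"
      "\<forall>j. j \<le> length X \<or> length X + length u \<le> j \<longrightarrow> c' ! j = c ! j" by auto
    obtain c'' where c'': "c'' \<in> chains" "Lam c'' = (X @ p) @ y # x # q @ Y"
      "\<And>j. j \<noteq> Suc (length (X @ p)) \<Longrightarrow> c'' ! j = c' ! j"
      using swap_chain[OF c'(1,2)] by blast
    have "c'' ! j = c ! j" if "j \<le> length X \<or> length X + length u \<le> j" for j
    proof -
      have "j \<noteq> Suc (length (X @ p))" using that Q by auto
      then show ?thesis using c''(3) c'(3) that by metis
    qed
    moreover have "Lam c'' = X @ (p @ y # x # q) @ Y" using c''(2) by simp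
    ultimately show "?Q (p @ y # x # q)" using c''(1) Q by (intro conjI bexI[of _ c'']) auto
  qed (rule assms(3))
  then show ?thesis using that by blast
qed

lemma words_closed:
  assumes "w \<in> words" "mset v = mset w"
  shows "v \<in> words"
proof -
  obtain c where "c \<in> chains" "Lam c = [] @ w @ []" using assms(1) by auto
  from rearrange_chain[OF this, of v] assms(2) show ?thesis by force
qed

lemma finite_words: "finite words"
  using finite_chains by simp

lemma length_word: "w \<in> words \<Longrightarrow> length w = n"
  using length_Lam by auto

text \<open>Closure of the words under rearrangement gives the induced action a value, and
  injectivity of \<open>Lam\<close> makes it unique. A word is fixed by a permutation exactly when
  it is fixed by the inverse, which absorbs the inverse in \<open>perm_seq\<close>.\<close>

lemma perm_character_words:
  assumes \<pi>: "\<pi> permutes {..<n}"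
  shows "perm_character P le n z t Lam \<pi> = card {w \<in> words. permute_list \<pi> w = w}"
proof -
  have inv: "inv \<pi> permutes {..<n}" using \<pi> by (rule permutes_inv)
  have iff: "perm_seq \<pi> w = w \<longleftrightarrow> permute_list \<pi> w = w" if "length w = n" for w :: "'l list"
  proof
    assume "perm_seq \<pi> w = w"
    then show "permute_list \<pi> w = w"
      using permute_list_compose[of \<pi> w "inv \<pi>"] \<pi> that permutes_inv_o(2)[OF \<pi>]
      by (simp add: perm_seq_def)
  next
    assume "permute_list \<pi> w = w"
    then show "perm_seq \<pi> w = w"
      using permute_list_compose[of "inv \<pi>" w \<pi>] inv that permutes_inv_o(1)[OF \<pi>]
      by (simp add: perm_seq_def)
  qed
  have fixed: "induced_action P le n z t Lam \<pi> c = c \<longleftrightarrow> permute_list \<pi> (Lam c) = Lam c"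
    if c: "c \<in> chains" for c
  proof -
    have "mset (perm_seq \<pi> (Lam c)) = mset (Lam c)"
      unfolding perm_seq_def using inv length_Lam[OF c] by simp
    then have "perm_seq \<pi> (Lam c) \<in> words" using words_closed c by blast
    then obtain d where d: "d \<in> chains" "Lam d = perm_seq \<pi> (Lam c)" by auto
    have "induced_action P le n z t Lam \<pi> c = d"
      unfolding induced_action_def
      by (rule the_equality) (use d inj_Lam in \<open>auto simp: inj_on_def\<close>)
    then have "induced_action P le n z t Lam \<pi> c = c \<longleftrightarrow> perm_seq \<pi> (Lam c) = Lam c"
      using d c inj_Lam by (auto simp: inj_on_def)
    then show ?thesis using iff length_Lam[OF c] by simp
  qed
  have "{w \<in> words. permute_list \<pi> w = w} = Lam ` {c \<in> chains. induced_action P le n z t Lam \<pi> c = c}"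
    using fixed by auto
  then show ?thesis
    unfolding perm_character_def
    by (simp only:) (rule card_image[symmetric], rule inj_on_subset[OF inj_Lam], auto)
qed

lemma frobenius_ch_perm_character:
  "frobenius_ch n (\<lambda>\<pi>. real (perm_character P le n z t Lam \<pi>)) \<alpha> =
    real (card {x :: (nat \<times> 'l) list. map snd x \<in> words \<and> count (mset (map fst x)) = \<alpha> \<and> sorted x})"
proof -
  have "frobenius_ch n (\<lambda>\<pi>. real (perm_character P le n z t Lam \<pi>)) \<alpha> =
      frobenius_ch n (\<lambda>\<pi>. real (card {w \<in> words. permute_list \<pi> w = w})) \<alpha>"
    unfolding frobenius_ch_def using perm_character_words by simp
  also have "\<dots> = real (card {x :: (nat \<times> 'l) list. map snd x \<in> words \<and>
      count (mset (map fst x)) = \<alpha> \<and> sorted x})"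
  proof (rule frobenius_ch_words[OF finite_words length_word])
    fix w \<pi> assume w: "w \<in> words" and \<pi>: "\<pi> permutes {..<n}"
    show "permute_list \<pi> w \<in> words"
      by (rule words_closed[OF w]) (use \<pi> length_word[OF w] in simp)
  qed
  finally show ?thesis .
qed

lemma frobenius_ch_h_expansion:
  "frobenius_ch n (\<lambda>\<pi>. real (perm_character P le n z t Lam \<pi>)) \<alpha> =
    (\<Sum>m\<in>mset ` words. h_part (mset_type m) \<alpha>)"
  unfolding frobenius_ch_perm_character h_part_mset_type
  by (subst card_words_by_content[OF finite_words words_closed]) simp_all

lemma flag_F_eq_frobenius_ch:
  assumes "R_labeling P le n z t Lam"
  shows "flag_F P le rho z t = frobenius_ch n (\<lambda>\<pi>. real (perm_character P le n z t Lam \<pi>))"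
proof
  fix \<alpha>
  show "flag_F P le rho z t \<alpha> = frobenius_ch n (\<lambda>\<pi>. real (perm_character P le n z t Lam \<pi>)) \<alpha>"
    using flag_F_words[OF assms[unfolded R_labeling_def] inj_Lam, of \<alpha>]
    unfolding frobenius_ch_perm_character lex_rel_le .
qed

lemma flag_F_e_expansion:
  assumes "Rstar_labeling P le n z t Lam"
  shows "flag_F P le rho z t \<alpha> = (\<Sum>m\<in>mset ` words. e_part (mset_type m) \<alpha>)"
  unfolding flag_F_words[OF assms[unfolded Rstar_labeling_def] inj_Lam] e_part_mset_type lex_rel_less
  by (subst card_words_by_content[OF finite_words words_closed]) simp_all

lemma word_type_partition: "mset_type ` mset ` words \<subseteq> partitions n"
proof
  fix \<mu> assume "\<mu> \<in> mset_type ` mset ` words"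
  then obtain c where "c \<in> chains" "\<mu> = mset_type (mset (Lam c))" by auto
  then show "\<mu> \<in> partitions n"
    using is_partition_mset_type[of "mset (Lam c)"] length_Lam[of c] by (simp add: partitions_def)
qed

lemma Rstar_labeling_conclusion:
  assumes "Rstar_labeling P le n z t Lam"
  shows "frobenius_ch n (\<lambda>\<pi>. real (perm_character P le n z t Lam \<pi>)) = omega n (flag_F P le rho z t)"
    and "e_positive n (flag_F P le rho z t)"
proof -
  \<comment> \<open>The number of rearrangement classes of type \<mu>: it is a coefficient of
    \<open>e_part \<mu>\<close> in the flag series and of \<open>h_part \<mu>\<close> in the
    characteristic, so \<open>omega\<close> takes one to the other; being a natural number, it
    yields positivity.\<close>
  define N where "N = (\<lambda>\<mu>. card {m \<in> mset ` words. mset_type m = \<mu>})"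
  note group = sum_over_types[OF finite_imageI[OF finite_words] word_type_partition]
  have F: "flag_F P le rho z t = (\<lambda>\<alpha>. \<Sum>\<mu>\<in>partitions n. real (N \<mu>) * e_part \<mu> \<alpha>)"
    by (rule ext) (simp add: flag_F_e_expansion[OF assms] group[of "\<lambda>\<mu>. e_part \<mu> _"] N_def)
  have ch: "frobenius_ch n (\<lambda>\<pi>. real (perm_character P le n z t Lam \<pi>)) =
      (\<lambda>\<alpha>. \<Sum>\<mu>\<in>partitions n. real (N \<mu>) * h_part \<mu> \<alpha>)"
    by (rule ext) (simp add: frobenius_ch_h_expansion group[of "\<lambda>\<mu>. h_part \<mu> _"] N_def)
  show "frobenius_ch n (\<lambda>\<pi>. real (perm_character P le n z t Lam \<pi>)) = omega n (flag_F P le rho z t)"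
    unfolding F ch by (rule omega_e_expansion[symmetric])
  show "e_positive n (flag_F P le rho z t)"
    unfolding e_positive_def using F by blast
qed

end

section \<open>Increasing labelings: one rearrangement class and a product of chains\<close>

locale RS_labeled = S_labeled P le rho n z t Lam
  for P :: "'a set" and le rho n z t and Lam :: "'a list \<Rightarrow> 'l::linorder list" +
  assumes R_labeling: "R_labeling P le n z t Lam"
begin

text \<open>The R-condition is applied to the one-element initial chain \<open>[z]\<close>; chains
  ending in \<open>z\<close> itself fall outside it, but there is only one.\<close>

lemma increasing_chain_unique:
  assumes "sat_chain ws" "sat_chain ws'" "last ws = last ws'" "sorted (lab ws)" "sorted (lab ws')"
  shows "ws = ws'"
proof (cases "last ws = z")
  case True
  have "vs = [z]" if "sat_chain vs" "last vs = z" for vs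
    using length_sat_chain[OF that(1)] sat_chain_nth_0[OF that(1)] that(2) rho_z
    by (cases vs) auto
  then show ?thesis using True assms by metis
next
  case False
  have split: "vs = [z] @ tl vs" if "sat_chain vs" for vs
    using sat_chain_nonempty[OF that] sat_chain_nth_0[OF that] by (cases vs) auto
  let ?V = "\<lambda>vs. vs \<noteq> [] \<and> sat_chain ([z] @ vs) \<and> last ([z] @ vs) = last ws \<and>
    sorted (drop (length [z] - 1) (lab ([z] @ vs)))"
  have V: "?V (tl vs)" if "sat_chain vs" "last vs = last ws" "sorted (lab vs)" for vs
  proof -
    have "tl vs \<noteq> []" using split[OF that(1)] that(2) False by (metis append_Nil2 last.simps)
    then show ?thesis using split[OF that(1)] that by simp
  qed
  have lst: "last ws \<in> P" using last_sat_chain_in[OF assms(1)] .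
  have "\<exists>!vs. ?V vs"
    by (rule R_labeling_gen_unique[OF R_labeling[unfolded R_labeling_def] sat_chain_z lst])
       (use z_le[OF lst] False in auto)
  then obtain vs where vs: "\<forall>y. ?V y \<longrightarrow> y = vs" by (elim ex1E) (rule that)
  have "tl ws = vs" by (rule vs[rule_format, OF V[OF assms(1) refl assms(4)]])
  moreover have "tl ws' = vs" by (rule vs[rule_format, OF V[OF assms(2) assms(3)[symmetric] assms(5)]])
  ultimately show ?thesis using split[OF assms(1)] split[OF assms(2)] by simp
qed

text \<open>Extend to a maximal chain and rearrange only the labels below the last element: by
  locality that element stays on the chain.\<close>

lemma sort_sat_chain:
  assumes "sat_chain ws"
  obtains ws' where "sat_chain ws'" "last ws' = last ws" "lab ws' = sort (lab ws)"
proof -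
  obtain c where c: "c \<in> chains" "take (length ws) c = ws" using extend_to_chain[OF assms] .
  obtain r where lw: "length ws = Suc r" using sat_chain_nonempty[OF assms] by (cases ws) auto
  have "Lam c = [] @ lab ws @ drop r (Lam c)" using lab_eq[OF c] lw by simp
  then obtain c' where c': "c' \<in> chains" "Lam c' = [] @ sort (lab ws) @ drop r (Lam c)"
    "\<And>j. j \<le> length ([] :: 'l list) \<or> length ([] :: 'l list) + length (lab ws) \<le> j \<Longrightarrow> c' ! j = c ! j"
    using rearrange_chain[OF c(1) _ mset_sort[symmetric]] by blast
  let ?ws = "take (Suc r) c'"
  have sc': "sat_chain c'" using c'(1) chains_iff by blast
  have len: "length c' = n + 1" "length c = n + 1" "length ws \<le> n + 1"
    using length_chain c'(1) c(1) length_sat_chain_le[OF assms] by auto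
  have sc: "sat_chain ?ws" by (rule sat_chain_take[OF sc']) (use lw in simp)
  have "last ?ws = c' ! r"
    using len lw by (simp add: last_conv_nth[OF sat_chain_nonempty[OF sc]] min_def)
  also have "\<dots> = c ! r" by (rule c'(3)) (simp add: length_lab[OF assms] lw)
  also have "\<dots> = take (length ws) c ! r" using lw by simp
  also have "\<dots> = last ws" using c(2) lw by (simp add: last_conv_nth[OF sat_chain_nonempty[OF assms]])
  finally have "last ?ws = last ws" .
  moreover have "lab ?ws = sort (lab ws)"
    using lab_take[OF sc', of "Suc r"] lab_chain[OF c'(1)] c'(2) len lw length_lab[OF assms] by simp
  ultimately show ?thesis using that sc by blast
qed

text \<open>Sorting the labels of both chains produces two increasing chains with the same end,
  which coincide.\<close>

lemma content_unique:
  assumes "sat_chain ws" "sat_chain ws'" "last ws = last ws'"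
  shows "mset (lab ws) = mset (lab ws')"
proof -
  obtain us where us: "sat_chain us" "last us = last ws" "lab us = sort (lab ws)"
    using sort_sat_chain[OF assms(1)] .
  obtain us' where us': "sat_chain us'" "last us' = last ws'" "lab us' = sort (lab ws')"
    using sort_sat_chain[OF assms(2)] .
  have "us = us'"
    by (rule increasing_chain_unique) (use us us' assms(3) in auto)
  then show ?thesis using us(3) us'(3) by (metis mset_sort)
qed

definition content :: "'a \<Rightarrow> 'l multiset" where
  "content x = mset (lab (SOME ws. sat_chain ws \<and> last ws = x))"

definition total_content :: "'l multiset" where
  "total_content = content t"

lemma content_last:
  assumes "sat_chain ws"
  shows "content (last ws) = mset (lab ws)"
  unfolding content_def
  by (rule content_unique)
     (use someI[of "\<lambda>us. sat_chain us \<and> last us = last ws" ws] assms in auto)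

lemma exists_sat_chain:
  assumes "x \<in> P"
  obtains ws where "sat_chain ws" "last ws = x"
proof -
  have "le (last [z]) x" using z_le[OF assms] by simp
  then show ?thesis using sat_chain_extend[OF sat_chain_z assms] that by blast
qed

lemma size_content: "x \<in> P \<Longrightarrow> size (content x) = rho x"
  by (metis content_last diff_Suc_1 exists_sat_chain length_lab length_sat_chain size_mset)

lemma mset_Lam: "c \<in> chains \<Longrightarrow> mset (Lam c) = total_content"
  using content_last[of c] lab_chain[of c] by (simp add: chains_iff total_content_def)

lemma words_eq: "words = {w. mset w = total_content}"
proof (intro equalityI subsetI)
  fix w assume "w \<in> {w. mset w = total_content}"
  moreover obtain c where "c \<in> chains" using extend_to_chain[OF sat_chain_z] by blast
  ultimately show "w \<in> words"
    using words_closed[of "Lam c" w] mset_Lam by simp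
qed (use mset_Lam in auto)

lemma size_total_content: "size total_content = n"
  using size_content[OF t_in] rho_t by (simp add: total_content_def)

lemma content_mono:
  assumes "x \<in> P" "y \<in> P" "le x y"
  shows "content x \<subseteq># content y"
proof -
  obtain ws where ws: "sat_chain ws" "last ws = x" using exists_sat_chain[OF assms(1)] .
  obtain vs where vs: "sat_chain (ws @ vs)" "last (ws @ vs) = y"
    using sat_chain_extend[OF ws(1) assms(2)] ws(2) assms(3) by blast
  have "lab ws = take (length ws - 1) (lab (ws @ vs))"
    using lab_take[OF vs(1), of "length ws"] sat_chain_nonempty[OF ws(1)] by simp
  then have "mset (lab (ws @ vs)) = mset (lab ws) + mset (drop (length ws - 1) (lab (ws @ vs)))"
    by (metis append_take_drop_id mset_append)
  then show ?thesis
    using content_last[OF ws(1)] content_last[OF vs(1)] ws(2) vs(2) by simp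
qed

text \<open>Start from a maximal chain through \<open>x\<close> and turn its labels into those of
  \<open>c\<close>, separately below and above rank \<open>rho x\<close>. Neither rearrangement
  moves \<open>x\<close>, and by injectivity of \<open>Lam\<close> the result is
  \<open>c\<close>.\<close>

lemma chain_through:
  assumes x: "x \<in> P" and c: "c \<in> chains" and prefix: "mset (take (rho x) (Lam c)) = content x"
  shows "c ! rho x = x"
proof -
  obtain ws where ws: "sat_chain ws" "last ws = x" using exists_sat_chain[OF x] .
  obtain c0 where c0: "c0 \<in> chains" "take (length ws) c0 = ws" using extend_to_chain[OF ws(1)] .
  let ?r = "rho x"
  have lw: "length ws = Suc ?r" using length_sat_chain[OF ws(1)] ws(2) by simp
  have r: "?r \<le> n" using rho_mono[OF x t_in le_t[OF x]] rho_t by simp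
  let ?u = "take ?r (Lam c)" and ?v = "drop ?r (Lam c)"
  have lab0: "lab ws = take ?r (Lam c0)" using lab_eq[OF c0] lw by simp
  have "Lam c0 = [] @ take ?r (Lam c0) @ drop ?r (Lam c0)" by simp
  moreover have m: "mset (take ?r (Lam c0)) = mset ?u"
    using content_last[OF ws(1)] ws(2) prefix lab0 by simp
  ultimately obtain c1 where c1: "c1 \<in> chains" "Lam c1 = [] @ ?u @ drop ?r (Lam c0)"
    "\<And>j. j \<le> length ([] :: 'l list) \<or> length ([] :: 'l list) + length (take ?r (Lam c0)) \<le> j \<Longrightarrow> c1 ! j = c0 ! j"
    using rearrange_chain[OF c0(1)] by blast
  \<comment> \<open>Both words have the same total content, so equal contents below leave equal
    contents above.\<close>
  have "mset ?u + mset ?v = mset ?u + mset (drop ?r (Lam c0))"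
    using mset_Lam[OF c] mset_Lam[OF c1(1)] c1(2) by (metis append_Nil append_take_drop_id mset_append)
  then have m2: "mset (drop ?r (Lam c0)) = mset ?v" by simp
  have "Lam c1 = ?u @ drop ?r (Lam c0) @ []" using c1(2) by simp
  then obtain c2 where c2: "c2 \<in> chains" "Lam c2 = ?u @ ?v @ []"
    "\<And>j. j \<le> length ?u \<or> length ?u + length (drop ?r (Lam c0)) \<le> j \<Longrightarrow> c2 ! j = c1 ! j"
    using rearrange_chain[OF c1(1) _ m2] by blast
  have "c2 = c" using c2(1,2) c inj_Lam by (simp add: inj_on_def)
  then have "c ! ?r = c1 ! ?r" using c2(3)[of ?r] length_Lam[OF c] r by simp
  also have "\<dots> = c0 ! ?r" using c1(3)[of ?r] by simp
  also have "\<dots> = take (length ws) c0 ! ?r" using lw by simp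
  also have "\<dots> = x"
    using c0(2) ws lw last_conv_nth[OF sat_chain_nonempty[OF ws(1)]] by simp
  finally show ?thesis .
qed

lemma content_subset_total: "x \<in> P \<Longrightarrow> content x \<subseteq># total_content"
  unfolding total_content_def using content_mono t_in le_t by blast

text \<open>A word that spells out \<open>content x\<close>, then the rest of
  \<open>content y\<close>, then the remaining letters labels a chain that passes through
  \<open>x\<close> and \<open>y\<close> in this order.\<close>

lemma content_reflects_le:
  assumes "x \<in> P" "y \<in> P" "content x \<subseteq># content y"
  shows "le x y"
proof -
  let ?a = "sorted_list_of_multiset (content x)"
  let ?b = "sorted_list_of_multiset (content y - content x)"
  let ?d = "sorted_list_of_multiset (total_content - content y)"
  have "mset (?a @ ?b @ ?d) = total_content"
    using assms(3) content_subset_total[OF assms(2)] by simp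
  then have "?a @ ?b @ ?d \<in> words" by (simp only: words_eq mem_Collect_eq)
  then obtain c where c: "c \<in> chains" "Lam c = ?a @ ?b @ ?d"
    by (elim imageE) (rule that, simp_all)
  have len: "length ?a = rho x"
    using size_content[OF assms(1)] by (metis mset_sorted_list_of_multiset size_mset)
  have len2: "length (?a @ ?b) = rho y"
    using size_content[OF assms(2)] assms(3)
    by (metis mset_append mset_sorted_list_of_multiset size_mset subset_mset.add_diff_inverse)
  have "c ! rho x = x"
    by (rule chain_through[OF assms(1) c(1)]) (use c(2) len in simp)
  moreover have "c ! rho y = y"
  proof (rule chain_through[OF assms(2) c(1)])
    have "take (rho y) (Lam c) = ?a @ ?b" using c(2) len2 by simp
    then show "mset (take (rho y) (Lam c)) = content y" using assms(3) by simp
  qed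
  moreover have "rho x \<le> rho y" using len len2 by simp
  moreover have "rho y < length c"
    using length_chain[OF c(1)] rho_mono[OF assms(2) t_in le_t[OF assms(2)]] rho_t by simp
  moreover have "sat_chain c" using c(1) chains_iff by blast
  ultimately show ?thesis using sat_chain_le[of c "rho x" "rho y"] by simp
qed

text \<open>Take a chain whose label word begins with the letters of \<open>s\<close>; its element
  at rank \<open>size s\<close> has content \<open>s\<close>.\<close>

lemma content_surj:
  assumes "s \<subseteq># total_content"
  obtains x where "x \<in> P" "content x = s"
proof -
  let ?a = "sorted_list_of_multiset s"
  let ?d = "sorted_list_of_multiset (total_content - s)"
  have "mset (?a @ ?d) = total_content" using assms by simp
  then have "?a @ ?d \<in> words" by (simp only: words_eq mem_Collect_eq)
  then obtain c where c: "c \<in> chains" "Lam c = ?a @ ?d"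
    by (elim imageE) (rule that, simp_all)
  have sc: "sat_chain c" using c(1) chains_iff by blast
  let ?ws = "take (Suc (length ?a)) c"
  have ws: "sat_chain ?ws" by (rule sat_chain_take[OF sc]) simp
  have "Suc (length ?a) \<le> length c"
    using length_chain[OF c(1)] length_Lam[OF c(1)] c(2) by (metis Suc_eq_plus1 Suc_le_mono le_add1 length_append)
  then have "lab ?ws = ?a" using lab_take[OF sc, of "Suc (length ?a)"] lab_chain[OF c(1)] c(2) by simp
  then have "content (last ?ws) = s" using content_last[OF ws] by simp
  then show ?thesis using that last_sat_chain_in[OF ws] by blast
qed

lemma content_inject:
  "x \<in> P \<Longrightarrow> y \<in> P \<Longrightarrow> content x = content y \<Longrightarrow> x = y"
  using content_reflects_le le_antisym by simp

text \<open>Multiplicities along \<open>letters total_content\<close> serve as coordinates: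
  inclusion of contents is then the componentwise order, and every vector within the bounds is
  reached by \<open>content_surj\<close>.\<close>

lemma iso_chain_product: "iso_to_chain_product P le (mset_type total_content)"
  unfolding iso_to_chain_product_def
proof (intro exI conjI ballI)
  let ?ls = "letters total_content"
  let ?f = "\<lambda>x. map (count (content x)) ?ls"
  \<comment> \<open>Bounding \<open>s\<close> is enough: letters outside the total content do not
    occur in \<open>s\<close>.\<close>
  have subset_iff: "s \<subseteq># s' \<longleftrightarrow> list_all2 (\<le>) (map (count s) ?ls) (map (count s') ?ls)"
    if "s \<subseteq># total_content" for s s'
  proof -
    have "s \<subseteq># s' \<longleftrightarrow> (\<forall>l\<in>set ?ls. count s l \<le> count s' l)"
    proof (intro iffI ballI)
      assume *: "\<forall>l\<in>set ?ls. count s l \<le> count s' l"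
      show "s \<subseteq># s'"
        unfolding subseteq_mset_def
      proof
        fix l
        show "count s l \<le> count s' l"
        proof (cases "l \<in># total_content")
          case False
          then have "l \<notin># s" using that by (meson mset_subset_eqD)
          then show ?thesis by (simp add: not_in_iff)
        qed (use * in \<open>simp add: set_letters\<close>)
      qed
    qed (simp add: subseteq_mset_def)
    then show ?thesis by (simp add: list_all2_conv_all_nth all_set_conv_all_nth)
  qed
  fix x y assume "x \<in> P" "y \<in> P"
  then show "le x y \<longleftrightarrow> list_all2 (\<le>) (?f x) (?f y)"
    using subset_iff[OF content_subset_total] content_mono content_reflects_le by blast
next
  let ?ls = "letters total_content"
  let ?f = "\<lambda>x. map (count (content x)) ?ls"
  have count_zero: "count (content x) l = 0" if "x \<in> P" "l \<notin> set ?ls" for x l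
    using content_subset_total[OF that(1)] that(2) by (metis mset_subset_eqD not_in_iff set_letters)
  show "bij_betw ?f P (chain_product (mset_type total_content))"
    unfolding bij_betw_def
  proof
    show "inj_on ?f P"
    proof (rule inj_onI)
      fix x y assume xy: "x \<in> P" "y \<in> P" "?f x = ?f y"
      have "content x = content y"
      proof (rule multiset_eqI)
        fix l
        show "count (content x) l = count (content y) l"
          using xy count_zero[of x l] count_zero[of y l] by (cases "l \<in> set ?ls") auto
      qed
      then show "x = y" using content_inject xy by blast
    qed
    show "?f ` P = chain_product (mset_type total_content)"
    proof (intro equalityI subsetI)
      fix xs assume "xs \<in> ?f ` P"
      then show "xs \<in> chain_product (mset_type total_content)"
        using content_subset_total by (auto simp: chain_product_def mset_type_def subseteq_mset_def)
    next
      fix xs assume "xs \<in> chain_product (mset_type total_content)"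
      then have len: "length xs = length ?ls"
        and le: "\<And>i. i < length ?ls \<Longrightarrow> xs ! i \<le> count total_content (?ls ! i)"
        by (auto simp: chain_product_def mset_type_def)
      \<comment> \<open>The multiplicity function encoded by a coordinate vector, with default 0 off
        the letters so that it has finite support and stays below the total content.\<close>
      define h where "h = (\<lambda>l. case map_of (zip ?ls xs) l of None \<Rightarrow> 0 | Some k \<Rightarrow> k)"
      have h: "h (?ls ! i) = xs ! i" if "i < length ?ls" for i
        using map_of_zip_nth[of ?ls xs i] len that distinct_letters[of total_content] by (simp add: h_def)
      have h0: "h l = 0" if "l \<notin> set ?ls" for l
      proof -
        have "map_of (zip ?ls xs) l = None" using that len by simp
        then show ?thesis by (simp add: h_def)
      qed
      define s where "s = Abs_multiset h"
      have "finite {l. 0 < h l}"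
        by (rule finite_subset[of _ "set ?ls"]) (use h0 in \<open>auto intro: ccontr\<close>)
      then have s: "count s = h" by (simp add: s_def)
      have "s \<subseteq># total_content"
        unfolding subseteq_mset_def
      proof
        fix l
        show "count s l \<le> count total_content l"
          using h0[of l] h le by (cases "l \<in> set ?ls") (auto simp: s in_set_conv_nth)
      qed
      then obtain x where x: "x \<in> P" "content x = s" using content_surj by blast
      have "?f x = xs" by (rule nth_equalityI) (use len h x s in auto)
      then show "xs \<in> ?f ` P" using x(1) by blast
    qed
  qed
qed

lemma R_labeling_conclusion:
  "is_partition n (mset_type total_content)"
  "frobenius_ch n (\<lambda>\<pi>. real (perm_character P le n z t Lam \<pi>)) = h_part (mset_type total_content)"
proof -
  show "is_partition n (mset_type total_content)"
    using is_partition_mset_type[of total_content] size_total_content by simp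
  \<comment> \<open>A maximal chain exists, so the set of classes is nonempty and the expansion has
    exactly one term.\<close>
  obtain c where "c \<in> chains" using extend_to_chain[OF sat_chain_z] by blast
  moreover have "mset ` words = (\<lambda>_. total_content) ` chains"
    by (simp add: image_image mset_Lam cong: image_cong_simp)
  ultimately have "mset ` words = {total_content}" by auto
  then show "frobenius_ch n (\<lambda>\<pi>. real (perm_character P le n z t Lam \<pi>)) = h_part (mset_type total_content)"
    by (intro ext) (simp add: frobenius_ch_h_expansion)
qed

end

theorem theorem4p4:
  fixes P :: "'a set" and le :: "'a \<Rightarrow> 'a \<Rightarrow> bool" and rho :: "'a \<Rightarrow> nat"
    and n :: nat and z t :: 'a and Lam :: "'a list \<Rightarrow> 'l::linorder list"
  assumes "ranked_poset P le rho n z t"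
    and "flag_symmetric P le rho z t"
    and "S_labeling P le n z t Lam"
  shows "(R_labeling P le n z t Lam \<longrightarrow>
           (\<exists>\<nu>. is_partition n \<nu> \<and>
              flag_F P le rho z t = frobenius_ch n (\<lambda>\<pi>. real (perm_character P le n z t Lam \<pi>)) \<and>
              frobenius_ch n (\<lambda>\<pi>. real (perm_character P le n z t Lam \<pi>)) = h_part \<nu> \<and>
              iso_to_chain_product P le \<nu>))
       \<and> (Rstar_labeling P le n z t Lam \<longrightarrow>
           frobenius_ch n (\<lambda>\<pi>. real (perm_character P le n z t Lam \<pi>)) = omega n (flag_F P le rho z t)
           \<and> e_positive n (flag_F P le rho z t))"
proof (intro conjI impI)
  assume R: "R_labeling P le n z t Lam"
  then interpret RS_labeled P le rho n z t Lam
    by unfold_locales (use assms in \<open>auto simp: R_labeling_def R_labeling_gen_def\<close>)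
  show "\<exists>\<nu>. is_partition n \<nu> \<and>
      flag_F P le rho z t = frobenius_ch n (\<lambda>\<pi>. real (perm_character P le n z t Lam \<pi>)) \<and>
      frobenius_ch n (\<lambda>\<pi>. real (perm_character P le n z t Lam \<pi>)) = h_part \<nu> \<and>
      iso_to_chain_product P le \<nu>"
    using R_labeling_conclusion flag_F_eq_frobenius_ch[OF R] iso_chain_product by blast
next
  assume R: "Rstar_labeling P le n z t Lam"
  then interpret S_labeled P le rho n z t Lam
    by unfold_locales (use assms in \<open>auto simp: Rstar_labeling_def R_labeling_gen_def\<close>)
  show "frobenius_ch n (\<lambda>\<pi>. real (perm_character P le n z t Lam \<pi>)) = omega n (flag_F P le rho z t)"
    and "e_positive n (flag_F P le rho z t)"
    by (fact Rstar_labeling_conclusion[OF R])+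
qed

end
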